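(* Let $(c_k)_{k\in\mathbb{N}}$ be a sequence of complex numbers and let $T_c$ be the infinite matrix whose $(i,j)$ entry ($i,j\in\mathbb{N}$) is $0$ if $j<i$, $c_i$ if $j=i$, and $c_j-c_{j-1}$ if $j>i$. Then: (1) $T_c$ defines a bounded operator on $\ell^2$ if and only if $\sup_k|c_k|<\infty$ and $\sup_{n\in\mathbb{N}}2^n\sum_{j=2^n}^{2^{n+1}-1}|c_j-c_{j+1}|^2<\infty$; (2) $T_c$ is compact on $\ell^2$ if and only if $\lim_{k\to\infty}|c_k|=0$ and $\lim_{n\to\infty}2^n\sum_{j=2^n}^{2^{n+1}-1}|c_j-c_{j+1}|^2=0$; (3) for $1<q<\infty$, $T_c\in\mathcal{S}^q(\ell^2)$ if and only if $\sum_k|c_k|^q<\infty$ and $\sum_{n\in\mathbb{N}}\big(2^n\sum_{j=2^n}^{2^{n+1}-1}|c_j-c_{j+1}|^2\big)^{q/2}<\infty$.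
   Context: $\mathbb{N}=\{0,1,2,\dots\}$; $\ell^2$ is the Hilbert space of square-summable sequences indexed by $\mathbb{N}$, with the standard basis. Thus $T_c$ has first row $(c_0, c_1-c_0, c_2-c_1, \dots)$, second row $(0, c_1, c_2-c_1, c_3-c_2,\dots)$, etc. For a bounded operator $T$, the approximation numbers are $a_{n+1}(T)=\inf\{\|T-P\|:\operatorname{rank}P\le n\}$ and $T\in\mathcal{S}^q(\ell^2)$ iff $(a_n(T))_{n\ge1}\in\ell^q$. *)

theory Defs
  imports "HOL-Analysis.Analysis"
begin

definition ell2 :: "(nat \<Rightarrow> complex) set" where
  "ell2 = {x. summable (\<lambda>i. (cmod (x i))^2)}"

definition l2norm :: "(nat \<Rightarrow> complex) \<Rightarrow> real" where
  "l2norm x = sqrt (\<Sum>i. (cmod (x i))^2)"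

definition Tmat :: "(nat \<Rightarrow> complex) \<Rightarrow> nat \<Rightarrow> nat \<Rightarrow> complex" where
  "Tmat c i j = (if j < i then 0 else if j = i then c i else c j - c (j - 1))"

definition mat_apply :: "(nat \<Rightarrow> nat \<Rightarrow> complex) \<Rightarrow> (nat \<Rightarrow> complex) \<Rightarrow> nat \<Rightarrow> complex" where
  "mat_apply M x = (\<lambda>i. \<Sum>j. M i j * x j)"

definition matrix_bounded :: "(nat \<Rightarrow> nat \<Rightarrow> complex) \<Rightarrow> bool" where
  "matrix_bounded M \<longleftrightarrow>
     (\<exists>C. \<forall>x\<in>ell2. (\<forall>i. summable (\<lambda>j. M i j * x j)) \<and>
                    mat_apply M x \<in> ell2 \<and> l2norm (mat_apply M x) \<le> C * l2norm x)"

definition matrix_compact :: "(nat \<Rightarrow> nat \<Rightarrow> complex) \<Rightarrow> bool" where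
  "matrix_compact M \<longleftrightarrow> matrix_bounded M \<and>
     (\<forall>xs :: nat \<Rightarrow> nat \<Rightarrow> complex. (\<forall>n. xs n \<in> ell2) \<and> bdd_above (range (\<lambda>n. l2norm (xs n))) \<longrightarrow>
        (\<exists>(r :: nat \<Rightarrow> nat) (y :: nat \<Rightarrow> complex). strict_mono r \<and> y \<in> ell2 \<and>
           (\<lambda>n. l2norm (\<lambda>i. mat_apply M (xs (r n)) i - y i)) \<longlonglongrightarrow> 0))"

definition bounded_op :: "((nat \<Rightarrow> complex) \<Rightarrow> nat \<Rightarrow> complex) \<Rightarrow> bool" where
  "bounded_op T \<longleftrightarrow>
     (\<forall>x\<in>ell2. T x \<in> ell2) \<and>
     (\<forall>x\<in>ell2. \<forall>y\<in>ell2. T (\<lambda>i. x i + y i) = (\<lambda>i. T x i + T y i)) \<and>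
     (\<forall>a. \<forall>x\<in>ell2. T (\<lambda>i. a * x i) = (\<lambda>i. a * T x i)) \<and>
     (\<exists>C. \<forall>x\<in>ell2. l2norm (T x) \<le> C * l2norm x)"

definition opnorm :: "((nat \<Rightarrow> complex) \<Rightarrow> nat \<Rightarrow> complex) \<Rightarrow> real" where
  "opnorm T = Sup {l2norm (T x) | x. x \<in> ell2 \<and> l2norm x \<le> 1}"

definition rank_le :: "((nat \<Rightarrow> complex) \<Rightarrow> nat \<Rightarrow> complex) \<Rightarrow> nat \<Rightarrow> bool" where
  "rank_le T n \<longleftrightarrow> (\<exists>v :: nat \<Rightarrow> nat \<Rightarrow> complex. (\<forall>k<n. v k \<in> ell2) \<and>
     (\<forall>x\<in>ell2. \<exists>a :: nat \<Rightarrow> complex. T x = (\<lambda>i. \<Sum>k<n. a k * v k i)))"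

text \<open>approx_num T n = a_{n+1}(T) = inf { norm (T - P) : P bounded, rank P \<le> n }.\<close>
definition approx_num :: "((nat \<Rightarrow> complex) \<Rightarrow> nat \<Rightarrow> complex) \<Rightarrow> nat \<Rightarrow> real" where
  "approx_num T n = Inf {opnorm (\<lambda>x i. T x i - P x i) | P. bounded_op P \<and> rank_le P n}"

definition matrix_schatten :: "real \<Rightarrow> (nat \<Rightarrow> nat \<Rightarrow> complex) \<Rightarrow> bool" where
  "matrix_schatten q M \<longleftrightarrow> matrix_bounded M \<and>
     summable (\<lambda>n. approx_num (mat_apply M) n powr q)"

definition dyadic_block :: "(nat \<Rightarrow> complex) \<Rightarrow> nat \<Rightarrow> real" where
  "dyadic_block c n = (2::real)^n * (\<Sum>j\<in>{2^n..<2^(n+1)}. (cmod (c j - c (j+1)))^2)"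

end

theory Submission
  imports Defs "HOL-Complex_Analysis.Great_Picard"
begin

text \<open>
  Write \<open>d j = c j - c (j - 1)\<close>, so that \<open>(T x) i = c i * x i + (\<Sum>j>i. d j * x j)\<close>, and let \<open>\<beta> n\<close> be the
  square root of the \<open>n\<close>-th dyadic quantity. A Schur test with the weight \<open>sqrt j\<close> bounds the
  triangular part by a constant times \<open>sup \<beta>\<close>. Conversely, the basis vectors and the normalised
  conjugates of \<open>d\<close> on the dyadic blocks test boundedness and compactness.

  For the Schatten classes, fix a threshold \<open>t\<close>. Blocks with \<open>\<beta> n < t\<close> contribute an operator of norm
  \<open>O(t)\<close>; a block with \<open>\<beta> n \<ge> t\<close> is cut into \<open>O(\<beta> n / t)\<close> intervals, on each of which the
  operator is rank one up to a Hilbert-Schmidt error \<open>t\<close>. Counting ranks at \<open>t = 1/2^l\<close> gives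
  \<open>\<Sum>n. a n powr q \<le> C * (\<Sum>k. cmod (c k) powr q + \<Sum>n. \<beta> n powr q)\<close>; convergence of the sum over \<open>l\<close>
  needs \<open>q > 1\<close>. In the other direction, for orthonormal \<open>f\<close> and \<open>g\<close> the numbers \<open>T (f k) \<bullet> g k\<close>
  are \<open>q\<close>-summable: decompose \<open>T\<close> into differences of approximants of error \<open>1/2^l\<close>, and use that
  an operator of rank \<open>r\<close> has diagonal sum at most \<open>r\<close> times its norm.
\<close>

section \<open>The Hilbert space of square-summable sequences\<close>

text \<open>Above the diagonal an entry of the matrix depends on its column alone, so all rows above
  a dyadic block see the same sum over that block; counting these rows gives the factor
  \<open>2^n\<close>. It also explains the weight: the sums of \<open>1 / sqrt (i + 1)\<close> over
  \<open>i < j\<close> grow like \<open>sqrt j\<close>, while the tails of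
  \<open>(cmod (d j))^2 * sqrt j\<close> beyond row \<open>i\<close> decay like
  \<open>1 / sqrt (i + 1)\<close>. Written with \<open>d\<close>, the blocks become
  \<open>{2^n<..2^(n+1)}\<close> and miss column 1, which has to be carried separately throughout.
  The condition q > 1 enters through the rank count: a block costs about \<beta> n / t ranks at
  every level t \<le> \<beta> n, and weighting by t powr q leaves \<beta> n times a series in t powr
  (q - 1), which is geometric over dyadic t only for q > 1. The converse avoids singular values. A
  difference of approximants is controlled only through the sum of its diagonal, an estimate of
  first order; its geometrically decreasing norm supplies the remaining power q - 1.\<close>

lemma ell2_add: "x \<in> ell2 \<Longrightarrow> y \<in> ell2 \<Longrightarrow> (\<lambda>i. x i + y i) \<in> ell2"
proof -
  assume "x \<in> ell2" "y \<in> ell2"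
  then have s: "summable (\<lambda>i. 2 * (cmod (x i))^2 + 2 * (cmod (y i))^2)"
    unfolding ell2_def by (auto intro!: summable_add summable_mult)
  have "norm ((cmod (x i + y i))^2) \<le> 2 * (cmod (x i))^2 + 2 * (cmod (y i))^2" for i
  proof -
    have "(cmod (x i + y i))^2 \<le> (cmod (x i) + cmod (y i))^2"
      by (intro power_mono norm_triangle_ineq) auto
    also have "\<dots> \<le> 2 * (cmod (x i))^2 + 2 * (cmod (y i))^2"
      using sum_squares_bound[of "cmod (x i)" "cmod (y i)"] by (simp add: power2_sum)
    finally show ?thesis by simp
  qed
  then show ?thesis
    unfolding ell2_def using summable_comparison_test'[OF s, of 0 "\<lambda>i. (cmod (x i + y i))^2"] by auto
qed

lemma ell2_scale: "x \<in> ell2 \<Longrightarrow> (\<lambda>i. a * x i) \<in> ell2"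
  unfolding ell2_def by (auto simp: norm_mult power_mult_distrib intro: summable_mult)

lemma ell2_zero [simp]: "(\<lambda>i. 0) \<in> ell2"
  unfolding ell2_def by simp

lemma ell2_diff: "x \<in> ell2 \<Longrightarrow> y \<in> ell2 \<Longrightarrow> (\<lambda>i. x i - y i) \<in> ell2"
  using ell2_add[of x "\<lambda>i. (-1) * y i"] ell2_scale[of y "-1"] by simp

lemma ell2_finite_support: "finite F \<Longrightarrow> (\<And>i. i \<notin> F \<Longrightarrow> x i = 0) \<Longrightarrow> x \<in> ell2"
  unfolding ell2_def by (auto intro!: summable_finite)

lemma summable_ell2_mult:
  assumes "x \<in> ell2" "y \<in> ell2"
  shows "summable (\<lambda>i. cmod (x i) * cmod (y i))"
proof (rule summable_comparison_test'[of "\<lambda>i. (cmod (x i))^2 + (cmod (y i))^2" 0])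
  show "summable (\<lambda>i. (cmod (x i))^2 + (cmod (y i))^2)"
    using assms unfolding ell2_def by (auto intro: summable_add)
  fix i
  have "0 \<le> cmod (x i) * cmod (y i)" by simp
  moreover have "2 * (cmod (x i) * cmod (y i)) \<le> (cmod (x i))^2 + (cmod (y i))^2"
    using sum_squares_bound[of "cmod (x i)" "cmod (y i)"] by (simp add: algebra_simps)
  ultimately show "norm (cmod (x i) * cmod (y i)) \<le> (cmod (x i))^2 + (cmod (y i))^2"
    unfolding real_norm_def by linarith
qed

lemma summable_ell2_inner:
  assumes "x \<in> ell2" "y \<in> ell2"
  shows "summable (\<lambda>i. x i \<bullet> y i)"
  by (rule summable_comparison_test'[OF summable_ell2_mult[OF assms], of 0])
    (simp add: Cauchy_Schwarz_ineq2)

text \<open>Made into a real inner product space, whose inner product is the real part of the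
  complex one. Phases of test vectors must therefore be chosen to make the relevant products real,
  and complex rank n becomes real dimension at most 2n; both cost at most constants.\<close>

typedef l2 = ell2
  by (rule exI[of _ "\<lambda>i. 0"]) simp

setup_lifting type_definition_l2

instantiation l2 :: real_inner
begin

lift_definition zero_l2 :: l2 is "\<lambda>i. 0" by simp
lift_definition plus_l2 :: "l2 \<Rightarrow> l2 \<Rightarrow> l2" is "\<lambda>x y i. x i + y i" by (rule ell2_add)
lift_definition minus_l2 :: "l2 \<Rightarrow> l2 \<Rightarrow> l2" is "\<lambda>x y i. x i - y i" by (rule ell2_diff)
lift_definition uminus_l2 :: "l2 \<Rightarrow> l2" is "\<lambda>x i. - x i"
  using ell2_scale[of _ "-1"] by simp
lift_definition scaleR_l2 :: "real \<Rightarrow> l2 \<Rightarrow> l2" is "\<lambda>r x i. r *\<^sub>R x i"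
  by (simp add: scaleR_conv_of_real ell2_scale)
lift_definition inner_l2 :: "l2 \<Rightarrow> l2 \<Rightarrow> real" is "\<lambda>x y. \<Sum>i. x i \<bullet> y i" .
definition norm_l2 :: "l2 \<Rightarrow> real" where "norm_l2 x = sqrt (x \<bullet> x)"
definition sgn_l2 :: "l2 \<Rightarrow> l2" where "sgn_l2 x = inverse (norm x) *\<^sub>R x"
definition dist_l2 :: "l2 \<Rightarrow> l2 \<Rightarrow> real" where "dist_l2 x y = norm (x - y)"
definition uniformity_l2 :: "(l2 \<times> l2) filter"
  where "uniformity_l2 = (INF e\<in>{0<..}. principal {(x, y). dist x y < e})"
definition open_l2 :: "l2 set \<Rightarrow> bool"
  where "open_l2 S \<longleftrightarrow> (\<forall>x\<in>S. \<forall>\<^sub>F (x', y) in uniformity. x' = x \<longrightarrow> y \<in> S)"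

instance
proof
  fix x y z :: l2 and r s :: real
  show "x + y + z = x + (y + z)" by transfer (simp add: add.assoc)
  show "x + y = y + x" by transfer (simp add: add.commute)
  show "0 + x = x" by transfer simp
  show "- x + x = 0" by transfer simp
  show "x - y = x + - y" by transfer simp
  show "r *\<^sub>R (x + y) = r *\<^sub>R x + r *\<^sub>R y" by transfer (simp add: scaleR_add_right)
  show "(r + s) *\<^sub>R x = r *\<^sub>R x + s *\<^sub>R x" by transfer (simp add: scaleR_add_left)
  show "r *\<^sub>R s *\<^sub>R x = (r * s) *\<^sub>R x" by transfer simp
  show "1 *\<^sub>R x = x" by transfer simp
  show "dist x y = norm (x - y)" by (rule dist_l2_def)
  show "sgn x = inverse (norm x) *\<^sub>R x" by (rule sgn_l2_def)
  show "norm x = sqrt (x \<bullet> x)" by (rule norm_l2_def)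
  show "uniformity = (INF e\<in>{0<..}. principal {(x::l2, y). dist x y < e})" by (rule uniformity_l2_def)
  fix S :: "l2 set"
  show "open S \<longleftrightarrow> (\<forall>x\<in>S. \<forall>\<^sub>F (x', y) in uniformity. x' = x \<longrightarrow> y \<in> S)" by (rule open_l2_def)
  show "x \<bullet> y = y \<bullet> x" by transfer (simp add: inner_commute)
  show "(x + y) \<bullet> z = x \<bullet> z + y \<bullet> z"
    by transfer (simp add: inner_add_left suminf_add summable_ell2_inner)
  show "r *\<^sub>R x \<bullet> y = r * (x \<bullet> y)"
    by transfer (simp add: suminf_mult summable_ell2_inner)
  show "0 \<le> x \<bullet> x" by transfer (simp add: suminf_nonneg summable_ell2_inner)
  show "x \<bullet> x = 0 \<longleftrightarrow> x = 0"
  proof transfer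
    fix x assume "x \<in> ell2"
    then have "(\<Sum>i. x i \<bullet> x i) = 0 \<longleftrightarrow> (\<forall>i. x i \<bullet> x i = 0)"
      by (intro suminf_eq_zero_iff summable_ell2_inner) auto
    then show "(\<Sum>i. x i \<bullet> x i) = 0 \<longleftrightarrow> x = (\<lambda>i. 0)" by (auto simp: fun_eq_iff)
  qed
qed

end

lemma norm_l2_eq: "norm x = l2norm (Rep_l2 x)"
  unfolding norm_l2_def l2norm_def inner_l2.rep_eq by (simp add: power2_norm_eq_inner)

lemma l2norm_eq: "x \<in> ell2 \<Longrightarrow> l2norm x = norm (Abs_l2 x)"
  by (simp add: norm_l2_eq Abs_l2_inverse)

lemma l2norm_nonneg [simp]: "x \<in> ell2 \<Longrightarrow> 0 \<le> l2norm x"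
  by (simp add: l2norm_eq)

lemma l2norm_zero [simp]: "l2norm (\<lambda>i. 0) = 0"
  unfolding l2norm_def by simp

lemma l2norm_add: "x \<in> ell2 \<Longrightarrow> y \<in> ell2 \<Longrightarrow> l2norm (\<lambda>i. x i + y i) \<le> l2norm x + l2norm y"
  using norm_triangle_ineq[of "Abs_l2 x" "Abs_l2 y"]
  by (simp add: l2norm_eq ell2_add plus_l2.abs_eq eq_onp_same_args)

lemma l2norm_diff: "x \<in> ell2 \<Longrightarrow> y \<in> ell2 \<Longrightarrow> l2norm (\<lambda>i. x i - y i) \<le> l2norm x + l2norm y"
  using norm_triangle_ineq4[of "Abs_l2 x" "Abs_l2 y"]
  by (simp add: l2norm_eq ell2_diff minus_l2.abs_eq eq_onp_same_args)

lemma l2norm_scale: "x \<in> ell2 \<Longrightarrow> l2norm (\<lambda>i. a * x i) = cmod a * l2norm x"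
  unfolding l2norm_def ell2_def
  by (simp add: norm_mult power_mult_distrib suminf_mult real_sqrt_mult)

lemma l2norm_power2: "x \<in> ell2 \<Longrightarrow> (l2norm x)^2 = (\<Sum>i. (cmod (x i))^2)"
  unfolding l2norm_def ell2_def by (simp add: suminf_nonneg)

lemma sum_le_l2norm_power2:
  assumes "x \<in> ell2" "finite F"
  shows "(\<Sum>i\<in>F. (cmod (x i))^2) \<le> (l2norm x)^2"
  unfolding l2norm_power2[OF assms(1)] using assms unfolding ell2_def by (intro sum_le_suminf) auto

lemma cmod_le_l2norm: "x \<in> ell2 \<Longrightarrow> cmod (x i) \<le> l2norm x"
  using sum_le_l2norm_power2[of x "{i}"] by (simp add: power2_le_iff_abs_le)

lemma ell2_bounded_sums:
  assumes "\<And>n. (\<Sum>i<n. (cmod (x i))^2) \<le> C^2" "0 \<le> C"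
  shows "x \<in> ell2" "l2norm x \<le> C"
proof -
  have s: "summable (\<lambda>i. (cmod (x i))^2)"
    by (rule summableI_nonneg_bounded[of _ "C^2"]) (auto simp: assms)
  then show "x \<in> ell2" by (simp add: ell2_def)
  have "(\<Sum>i. (cmod (x i))^2) \<le> C^2"
    by (rule suminf_le_const[OF s]) (simp add: assms)
  then show "l2norm x \<le> C" unfolding l2norm_def using assms(2)
    by (metis real_sqrt_le_mono real_sqrt_abs abs_of_nonneg)
qed

lemma l2norm_finite_support:
  assumes "finite F" "\<And>i. i \<notin> F \<Longrightarrow> x i = 0"
  shows "(l2norm x)^2 = (\<Sum>i\<in>F. (cmod (x i))^2)"
proof -
  have "(\<Sum>i. (cmod (x i))^2) = (\<Sum>i\<in>F. (cmod (x i))^2)"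
    by (rule suminf_finite) (use assms in auto)
  then show ?thesis using l2norm_power2[OF ell2_finite_support[OF assms]] by simp
qed

subsection \<open>Diagonal sums of finite rank operators\<close>

text \<open>Both sides are linear in \<open>y\<close> and agree on \<open>C\<close>. A zero vector
  in \<open>C\<close> is harmless, since its coefficient is 0 / 0 = 0.\<close>

lemma orthogonal_expansion:
  fixes C :: "'a::real_inner set"
  assumes "finite C" "pairwise orthogonal C" "y \<in> span C"
  shows "y = (\<Sum>h\<in>C. ((y \<bullet> h) / (h \<bullet> h)) *\<^sub>R h)"
  using assms(3)
proof (induction rule: span_induct_alt)
  case base
  then show ?case by simp
next
  case (step a u y)
  have "(\<Sum>h\<in>C. ((u \<bullet> h) / (h \<bullet> h)) *\<^sub>R h) = (\<Sum>h\<in>C. if h = u then u else 0)"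
    using assms(2) step(1)
    by (intro sum.cong refl) (auto simp: pairwise_def orthogonal_def)
  also have "\<dots> = u" using assms(1) step(1) by simp
  finally have u: "(\<Sum>h\<in>C. ((u \<bullet> h) / (h \<bullet> h)) *\<^sub>R h) = u" .
  have "(\<Sum>h\<in>C. (((a *\<^sub>R u + y) \<bullet> h) / (h \<bullet> h)) *\<^sub>R h) =
     a *\<^sub>R (\<Sum>h\<in>C. ((u \<bullet> h) / (h \<bullet> h)) *\<^sub>R h) + (\<Sum>h\<in>C. ((y \<bullet> h) / (h \<bullet> h)) *\<^sub>R h)"
    by (simp add: inner_add_left add_divide_distrib scaleR_add_left sum.distrib scaleR_sum_right)
  then show ?case using u step(2) by simp
qed

text \<open>Norms at most one, rather than equal to one, admit the zero test vectors that arise from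
  vanishing entries or vanishing blocks.\<close>

lemma norm_orthogonal_sum_le:
  fixes f :: "'i \<Rightarrow> 'a::real_inner"
  assumes "finite F" "pairwise (\<lambda>i j. f i \<bullet> f j = 0) F" "\<And>k. k \<in> F \<Longrightarrow> norm (f k) \<le> 1"
  shows "(norm (\<Sum>k\<in>F. a k *\<^sub>R f k))^2 \<le> (\<Sum>k\<in>F. (a k)^2)"
proof -
  have "(norm (\<Sum>k\<in>F. a k *\<^sub>R f k))^2 = (\<Sum>k\<in>F. (norm (a k *\<^sub>R f k))^2)"
    using assms(1,2)
    by (intro norm_sum_Pythagorean) (auto simp: pairwise_def orthogonal_def)
  also have "\<dots> \<le> (\<Sum>k\<in>F. (a k)^2)"
    using assms(3) by (intro sum_mono)
      (auto simp: power_mult_distrib intro!: mult_left_le power_le_one)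
  finally show ?thesis .
qed

text \<open>Bessel's inequality for the functional \<open>x \<mapsto> K x \<bullet> h\<close>, by duality: test it on the combination
  of the \<open>f k\<close> with its own coefficients.\<close>

lemma bessel_linear:
  fixes K :: "'a::real_inner \<Rightarrow> 'b::real_inner"
  assumes "linear K" "\<And>x. norm (K x) \<le> A * norm x" "0 \<le> A"
    and "finite F" "pairwise (\<lambda>i j. f i \<bullet> f j = 0) F" "\<And>k. k \<in> F \<Longrightarrow> norm (f k) \<le> 1"
  shows "sqrt (\<Sum>k\<in>F. (K (f k) \<bullet> h)^2) \<le> A * norm h"
proof -
  define a where "a k = K (f k) \<bullet> h" for k
  define s where "s = sqrt (\<Sum>k\<in>F. (a k)^2)"
  have s0: "0 \<le> s" unfolding s_def by (simp add: sum_nonneg)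
  have ss: "s^2 = (\<Sum>k\<in>F. (a k)^2)" unfolding s_def by (simp add: sum_nonneg)
  have "s^2 = K (\<Sum>k\<in>F. a k *\<^sub>R f k) \<bullet> h"
    unfolding ss by (simp add: linear_sum[OF assms(1)] linear_scale[OF assms(1)] inner_sum_left
        a_def power2_eq_square)
  also have "\<dots> \<le> norm (K (\<Sum>k\<in>F. a k *\<^sub>R f k)) * norm h" by (rule norm_cauchy_schwarz)
  also have "\<dots> \<le> (A * norm (\<Sum>k\<in>F. a k *\<^sub>R f k)) * norm h"
    by (intro mult_right_mono assms) auto
  also have "\<dots> \<le> (A * s) * norm h"
    using norm_orthogonal_sum_le[OF assms(4-6), of a] s0 unfolding ss[symmetric]
    by (intro mult_right_mono mult_left_mono assms) (auto simp: power2_le_iff_abs_le)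
  finally have "s * s \<le> s * (A * norm h)" by (simp add: power2_eq_square algebra_simps)
  then have "s \<le> A * norm h" using s0 assms(3)
    by (cases "s = 0") (auto simp: mult_le_cancel_left)
  then show ?thesis unfolding s_def a_def .
qed

text \<open>Expand \<open>K (f k)\<close> in an orthogonal spanning set \<open>C\<close> of
  \<open>span B\<close>. For a fixed \<open>h\<close> in \<open>C\<close>, Cauchy-Schwarz over
  \<open>k\<close> and Bessel's inequality for \<open>K\<close> along \<open>f\<close> and for the
  identity along \<open>g\<close> bound the contribution by \<open>A\<close>; there are at most
  \<open>card B\<close> such \<open>h\<close>. A substitute for the trace norm bound.\<close>

lemma finite_rank_diagonal_sum_le:
  fixes K :: "'a::real_inner \<Rightarrow> 'a"
  assumes "linear K" "\<And>x. norm (K x) \<le> A * norm x" "0 \<le> A"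
    and "finite B" "\<And>x. K x \<in> span B"
    and "finite F"
    and "pairwise (\<lambda>i j. f i \<bullet> f j = 0) F" "\<And>k. k \<in> F \<Longrightarrow> norm (f k) \<le> 1"
    and "pairwise (\<lambda>i j. g i \<bullet> g j = 0) F" "\<And>k. k \<in> F \<Longrightarrow> norm (g k) \<le> 1"
  shows "(\<Sum>k\<in>F. \<bar>K (f k) \<bullet> g k\<bar>) \<le> real (card B) * A"
proof -
  obtain C where C: "finite C" "card C \<le> card B" "span C = span B" "pairwise orthogonal C"
    using basis_orthogonal[OF assms(4)] by blast
  have h: "(\<Sum>k\<in>F. \<bar>K (f k) \<bullet> h\<bar> * \<bar>g k \<bullet> h\<bar>) / (h \<bullet> h) \<le> A" for h
  proof (cases "h = 0")
    case False
    have "(\<Sum>k\<in>F. \<bar>K (f k) \<bullet> h\<bar> * \<bar>g k \<bullet> h\<bar>) \<le>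
       sqrt (\<Sum>k\<in>F. (K (f k) \<bullet> h)^2) * sqrt (\<Sum>k\<in>F. (g k \<bullet> h)^2)"
      using L2_set_mult_ineq[of "\<lambda>k. K (f k) \<bullet> h" "\<lambda>k. g k \<bullet> h" F] by (simp add: L2_set_def)
    also have "\<dots> \<le> (A * norm h) * (1 * norm h)"
      using bessel_linear[OF assms(1-3,6-8), of h]
        bessel_linear[of "\<lambda>x. x" 1 F g h] assms
      by (intro mult_mono) (auto simp: sum_nonneg linear_id[unfolded id_def])
    also have "\<dots> = A * (h \<bullet> h)" by (simp add: power2_norm_eq_inner[symmetric] power2_eq_square)
    finally show ?thesis using False by (simp add: divide_le_eq)
  qed (use assms in auto)
  have "(\<Sum>k\<in>F. \<bar>K (f k) \<bullet> g k\<bar>) \<le> (\<Sum>k\<in>F. \<Sum>h\<in>C. (\<bar>K (f k) \<bullet> h\<bar> * \<bar>g k \<bullet> h\<bar>) / (h \<bullet> h))"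
  proof (intro sum_mono)
    fix k
    have "K (f k) \<bullet> g k = (\<Sum>h\<in>C. ((K (f k) \<bullet> h) / (h \<bullet> h)) *\<^sub>R h) \<bullet> g k"
      using orthogonal_expansion[OF C(1,4), of "K (f k)"] C(3) assms(5) by simp
    also have "\<dots> = (\<Sum>h\<in>C. ((K (f k) \<bullet> h) * (g k \<bullet> h)) / (h \<bullet> h))"
      by (simp add: inner_sum_left inner_sum_right inner_commute[of _ "g k"])
    also have "\<bar>\<dots>\<bar> \<le> (\<Sum>h\<in>C. (\<bar>K (f k) \<bullet> h\<bar> * \<bar>g k \<bullet> h\<bar>) / (h \<bullet> h))"
      by (rule order_trans[OF sum_abs]) (simp add: abs_mult)
    finally show "\<bar>K (f k) \<bullet> g k\<bar> \<le> (\<Sum>h\<in>C. (\<bar>K (f k) \<bullet> h\<bar> * \<bar>g k \<bullet> h\<bar>) / (h \<bullet> h))" .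
  qed
  also have "\<dots> = (\<Sum>h\<in>C. (\<Sum>k\<in>F. \<bar>K (f k) \<bullet> h\<bar> * \<bar>g k \<bullet> h\<bar>) / (h \<bullet> h))"
    by (subst sum.swap) (simp add: sum_divide_distrib)
  also have "\<dots> \<le> (\<Sum>h\<in>C. A)" by (intro sum_mono h)
  also have "\<dots> \<le> real (card B) * A" using C(2) assms(3) by (simp add: mult_right_mono)
  finally show ?thesis .
qed

subsection \<open>Boundedness of triangular operators\<close>

definition tri :: "(nat \<Rightarrow> complex) \<Rightarrow> (nat \<Rightarrow> complex) \<Rightarrow> nat \<Rightarrow> complex" where
  "tri w x i = (\<Sum>j. if i < j then w j * x j else 0)"

text \<open>The interval is open on the left because the difference \<open>c j - c (j+1)\<close> is
  attached to the column \<open>j + 1\<close>. Hence index 1 lies in no block.\<close>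

definition blk :: "(nat \<Rightarrow> complex) \<Rightarrow> nat \<Rightarrow> real" where
  "blk w n = 2^n * (\<Sum>j\<in>{2^n<..2^(n+1)}. (cmod (w j))^2)"

text \<open>Induction on the number of blocks, peeling off the first one: on it
  \<open>sqrt j\<close> is at most \<open>sqrt 2 * sqrt (2^n)\<close>, and the rest starts at
  \<open>n + 1\<close>, where the bound is smaller by the factor \<open>sqrt 2\<close>.\<close>

lemma weighted_dyadic_tail:
  assumes "\<And>n. blk w n \<le> B^2"
  shows "(\<Sum>j\<in>{2^n<..2^(n+N)}. (cmod (w j))^2 * sqrt (real j)) \<le> 5 * B^2 / sqrt (2^n)"
proof (induction N arbitrary: n)
  case 0
  then show ?case by simp
next
  case (Suc N)
  have "{a<..d} = {a<..b} \<union> {b<..d}" if "a \<le> b" "b \<le> d" for a b d :: nat using that by auto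
  from this[of "2^n" "2^(n+1)" "2^(n+1+N)"]
  have "{2^n<..2^(n+Suc N)} = {2^n<..2^(n+1)} \<union> {2^(n+1)<..(2::nat)^(n+1+N)}"
    by (simp add: power_increasing)
  then have split: "(\<Sum>j\<in>{2^n<..2^(n+Suc N)}. (cmod (w j))^2 * sqrt (real j)) =
      (\<Sum>j\<in>{2^n<..2^(n+1)}. (cmod (w j))^2 * sqrt (real j)) +
      (\<Sum>j\<in>{2^(n+1)<..2^(n+1+N)}. (cmod (w j))^2 * sqrt (real j))"
    by (simp add: sum.union_disjoint)
  define s where "s = sqrt (2^n :: real)"
  have s: "s > 0" "s * s = 2^n" by (simp_all add: s_def)
  have "(\<Sum>j\<in>{2^n<..2^(n+1)}. (cmod (w j))^2 * sqrt (real j)) \<le>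
      (\<Sum>j\<in>{2^n<..2^(n+1)}. (cmod (w j))^2 * (sqrt 2 * s))"
  proof (intro sum_mono mult_left_mono)
    fix j assume "j \<in> {2^n<..2^(n+1)::nat}"
    then have "real j \<le> real (2^(n+1))" by (simp only: of_nat_le_iff) simp
    then have "sqrt (real j) \<le> sqrt (2 * 2^n)" by simp
    then show "sqrt (real j) \<le> sqrt 2 * s" by (simp add: s_def real_sqrt_mult)
  qed simp
  also have "\<dots> = (\<Sum>j\<in>{2^n<..2^(n+1)}. (cmod (w j))^2) * (sqrt 2 * s)"
    by (simp add: sum_distrib_right)
  also have "\<dots> = sqrt 2 * blk w n / s"
    using s by (simp add: blk_def field_simps)
  also have "\<dots> \<le> sqrt 2 * B^2 / s"
    using s assms[of n] by (intro divide_right_mono mult_left_mono) auto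
  finally have 1: "(\<Sum>j\<in>{2^n<..2^(n+1)}. (cmod (w j))^2 * sqrt (real j)) \<le> sqrt 2 * B^2 / s" .
  have 2: "(\<Sum>j\<in>{2^(n+1)<..2^(n+1+N)}. (cmod (w j))^2 * sqrt (real j)) \<le> 5 * B^2 / (sqrt 2 * s)"
    using Suc.IH[of "n+1"] by (simp add: s_def real_sqrt_mult)
  have r: "sqrt 2 \<ge> 7/5" by (rule real_le_rsqrt) (simp add: power2_eq_square)
  \<comment> \<open>The constant 5 is chosen to close the induction:
    \<open>sqrt 2 + 5 / sqrt 2 = 7 / sqrt 2\<close>, which is at most 5 because
    \<open>sqrt 2\<close> is at least 7/5.\<close>
  have "sqrt 2 * B^2 / s + 5 * B^2 / (sqrt 2 * s) = (7 / sqrt 2) * (B^2 / s)"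
    using s by (simp add: field_simps)
  also have "\<dots> \<le> 5 * (B^2 / s)"
    using s r by (intro mult_right_mono) (auto simp: field_simps)
  finally show ?case unfolding split using 1 2 by (simp add: s_def)
qed

text \<open>Rounding \<open>i\<close> down to a power of two loses at most \<open>sqrt 2\<close>,
  and \<open>5 * sqrt 2\<close> is at most 8. Row 0 is separate: it also sees column 1, which
  belongs to no block and adds at most \<open>B^2\<close>.\<close>

lemma weighted_tail:
  assumes "\<And>n. blk w n \<le> B^2" "cmod (w 1) \<le> B"
  shows "(\<Sum>j\<in>{i<..J}. (cmod (w j))^2 * sqrt (real j)) \<le> 8 * B^2 / sqrt (real i + 1)"
proof (cases "i = 0")
  case True
  have "(\<Sum>j\<in>{i<..J}. (cmod (w j))^2 * sqrt (real j)) \<le>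
      (\<Sum>j\<in>insert 1 {2^0<..2^(0+J)}. (cmod (w j))^2 * sqrt (real j))"
    using True by (intro sum_mono2) (auto intro: order_trans[OF _ less_imp_le[OF less_exp]])
  also have "\<dots> = (cmod (w 1))^2 + (\<Sum>j\<in>{2^0<..2^(0+J)}. (cmod (w j))^2 * sqrt (real j))"
    by (subst sum.insert) auto
  also have "\<dots> \<le> B^2 + 5 * B^2 / sqrt (2^0)"
    using weighted_dyadic_tail[OF assms(1), of 0 J] assms(2)
    by (intro add_mono power_mono) auto
  also have "\<dots> \<le> 8 * B^2 / sqrt (real i + 1)" using True by simp
  finally show ?thesis .
next
  case False
  then obtain m where m: "2^m \<le> i" "i < 2^(m+1)"
    using ex_power_ivl1[of 2 i] by auto
  have J: "J \<le> 2^(m+J)"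
    using less_exp[of J] power_increasing[of J "m+J" "2::nat"] by linarith
  have "(\<Sum>j\<in>{i<..J}. (cmod (w j))^2 * sqrt (real j)) \<le>
      (\<Sum>j\<in>{2^m<..2^(m+J)}. (cmod (w j))^2 * sqrt (real j))"
    using m J by (intro sum_mono2) auto
  also have "\<dots> \<le> 5 * B^2 / sqrt (2^m)" by (rule weighted_dyadic_tail[OF assms(1)])
  also have "\<dots> \<le> 8 * B^2 / sqrt (real i + 1)"
  proof -
    have "i + 1 \<le> 2 * 2^m" using m by simp
    then have "real (i + 1) \<le> real (2 * 2^m)" by (simp only: of_nat_le_iff)
    then have "sqrt (real i + 1) \<le> sqrt (2 * 2^m)" by simp
    then have "sqrt (real i + 1) \<le> sqrt 2 * sqrt (2^m)" by (simp add: real_sqrt_mult)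
    moreover have "sqrt 2 \<le> 8/5" by (rule real_le_lsqrt) (auto simp: power2_eq_square)
    then have "sqrt 2 * sqrt (2^m) \<le> 8/5 * sqrt (2^m :: real)" by (intro mult_right_mono) auto
    ultimately have "5 * sqrt (real i + 1) \<le> 8 * sqrt (2^m)" by linarith
    then have "B^2 * (5 * sqrt (real i + 1)) \<le> B^2 * (8 * sqrt (2^m))"
      by (intro mult_left_mono) auto
    then show ?thesis by (simp add: divide_le_eq le_divide_eq field_simps)
  qed
  finally show ?thesis .
qed

lemma sum_inverse_sqrt_le: "(\<Sum>i<j. 1 / sqrt (real i + 1)) \<le> 2 * sqrt (real j)"
proof (induction j)
  case (Suc j)
  define a b where "a = sqrt (real j)" and "b = sqrt (real j + 1)"
  have ab: "0 \<le> a" "a \<le> b" "0 < b" "b^2 = a^2 + 1" unfolding a_def b_def by auto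
  have "1 = (b - a) * (b + a)" using ab(4) by (simp add: power2_eq_square algebra_simps)
  also have "\<dots> \<le> (b - a) * (2 * b)" using ab by (intro mult_left_mono) auto
  finally have "1 / b \<le> 2 * (b - a)" using ab by (simp add: field_simps)
  then show ?case using Suc by (simp add: a_def b_def add.commute)
qed simp

text \<open>A weighted Schur test with the weight \<open>sqrt j\<close> on the columns.\<close>

lemma tri_truncated_bound:
  assumes "\<And>n. blk w n \<le> B^2" "cmod (w 1) \<le> B" "x \<in> ell2"
  shows "(\<Sum>i<N. (\<Sum>j\<in>{i<..J}. cmod (w j * x j))^2) \<le> (4 * B * l2norm x)^2"
proof -
  define y where "y j = (cmod (x j))^2 / sqrt (real j)" for j
  have y0: "0 \<le> y j" for j by (simp add: y_def)
  have "(\<Sum>j\<in>{i<..J}. cmod (w j * x j))^2 \<le> 8 * B^2 * (1 / sqrt (real i + 1) * (\<Sum>j\<in>{i<..J}. y j))"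
    for i
  proof -
    \<comment> \<open>Fourth roots of \<open>j\<close>, so that squaring in Cauchy-Schwarz produces
      the weight \<open>sqrt j\<close>. Division is legitimate as \<open>j > i\<close> forces
      \<open>j > 0\<close>.\<close>
    have "(\<Sum>j\<in>{i<..J}. cmod (w j * x j)) =
        (\<Sum>j\<in>{i<..J}. (cmod (w j) * sqrt (sqrt (real j))) * (cmod (x j) / sqrt (sqrt (real j))))"
      by (intro sum.cong) (auto simp: norm_mult)
    also have "(\<dots>)^2 \<le> (\<Sum>j\<in>{i<..J}. (cmod (w j) * sqrt (sqrt (real j)))^2) *
        (\<Sum>j\<in>{i<..J}. (cmod (x j) / sqrt (sqrt (real j)))^2)"
      by (rule Cauchy_Schwarz_ineq_sum)
    also have "\<dots> = (\<Sum>j\<in>{i<..J}. (cmod (w j))^2 * sqrt (real j)) * (\<Sum>j\<in>{i<..J}. y j)"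
      by (simp add: power_mult_distrib power_divide y_def)
    also have "\<dots> \<le> (8 * B^2 / sqrt (real i + 1)) * (\<Sum>j\<in>{i<..J}. y j)"
      by (intro mult_right_mono weighted_tail assms sum_nonneg y0)
    finally show ?thesis by simp
  qed
  then have "(\<Sum>i<N. (\<Sum>j\<in>{i<..J}. cmod (w j * x j))^2) \<le>
      (\<Sum>i<N. 8 * B^2 * (1 / sqrt (real i + 1) * (\<Sum>j\<in>{i<..J}. y j)))"
    by (rule sum_mono)
  also have "\<dots> = 8 * B^2 * (\<Sum>i<N. \<Sum>j\<in>{i<..J}. y j * (1 / sqrt (real i + 1)))"
    by (simp add: sum_distrib_left sum_distrib_right)
  \<comment> \<open>Summing over the rows first gives at most \<open>2 * sqrt j\<close> in column
    \<open>j\<close>, which cancels the denominator of \<open>y j\<close>. The total constant 8 * 2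
    is the square of the 4 in the claim.\<close>
  also have "(\<Sum>i<N. \<Sum>j\<in>{i<..J}. y j * (1 / sqrt (real i + 1))) =
      (\<Sum>j\<le>J. \<Sum>i | i < N \<and> i < j. y j * (1 / sqrt (real i + 1)))"
  proof -
    have "(\<Sum>i<N. \<Sum>j\<in>{i<..J}. y j * (1 / sqrt (real i + 1))) =
      (\<Sum>i<N. \<Sum>j | j \<in> {..J} \<and> i < j. y j * (1 / sqrt (real i + 1)))"
      by (intro sum.cong) auto
    also have "\<dots> = (\<Sum>j\<le>J. \<Sum>i | i \<in> {..<N} \<and> i < j. y j * (1 / sqrt (real i + 1)))"
      by (rule sum.swap_restrict) auto
    finally show ?thesis by simp
  qed
  also have "8 * B^2 * \<dots> \<le> 8 * B^2 * (\<Sum>j\<le>J. 2 * (cmod (x j))^2)"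
  proof (intro mult_left_mono sum_mono)
    fix j
    have "(\<Sum>i | i < N \<and> i < j. y j * (1 / sqrt (real i + 1))) \<le> (\<Sum>i<j. y j * (1 / sqrt (real i + 1)))"
      by (intro sum_mono2) (auto simp: y0)
    also have "\<dots> = y j * (\<Sum>i<j. 1 / sqrt (real i + 1))" by (simp add: sum_distrib_left)
    also have "\<dots> \<le> y j * (2 * sqrt (real j))" by (intro mult_left_mono sum_inverse_sqrt_le y0)
    also have "\<dots> \<le> 2 * (cmod (x j))^2" by (cases "j = 0") (auto simp: y_def)
    finally show "(\<Sum>i | i < N \<and> i < j. y j * (1 / sqrt (real i + 1))) \<le> 2 * (cmod (x j))^2" .
  qed auto
  also have "\<dots> = 16 * B^2 * (\<Sum>j\<le>J. (cmod (x j))^2)" by (simp add: sum_distrib_left mult.assoc)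
  also have "\<dots> \<le> 16 * B^2 * (l2norm x)^2"
    by (intro mult_left_mono sum_le_l2norm_power2 assms) auto
  finally show ?thesis by (simp add: power_mult_distrib)
qed

lemma sum_up_to_eq: "(\<Sum>j\<le>J. if i < j then f j else 0) = sum f {i<..J::nat}"
  by (simp add: sum.If_cases) (rule sum.cong, auto)

text \<open>The truncated bound is uniform in \<open>J\<close> and \<open>N\<close>: it first yields
  absolute convergence of each row, and then passes to the limit in \<open>J\<close> for finitely
  many rows.\<close>

lemma tri_bounded:
  assumes "\<And>n. blk w n \<le> B^2" "cmod (w 1) \<le> B" "x \<in> ell2"
  shows summable_tri: "summable (\<lambda>j. if i < j then w j * x j else 0)"
    and tri_ell2: "tri w x \<in> ell2"
    and l2norm_tri_le: "l2norm (tri w x) \<le> 4 * B * l2norm x"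
proof -
  have C: "0 \<le> 4 * B * l2norm x" using assms(2) assms(3) order_trans[OF norm_ge_zero] by fastforce
  have sum: "summable (\<lambda>j. if i < j then w j * x j else 0)" for i
  proof -
    have le: "(\<Sum>j\<in>{i<..J}. cmod (w j * x j)) \<le> 4 * B * l2norm x" for J
    proof -
      \<comment> \<open>A single row is one summand of the truncated estimate for the first
        \<open>i + 1\<close> rows.\<close>
      have "(\<Sum>j\<in>{i<..J}. cmod (w j * x j))^2 \<le> (\<Sum>i<Suc i. (\<Sum>j\<in>{i<..J}. cmod (w j * x j))^2)"
        by (simp add: sum_nonneg)
      also have "\<dots> \<le> (4 * B * l2norm x)^2" by (rule tri_truncated_bound[OF assms])
      finally show ?thesis using C by (rule power2_le_imp_le)
    qed
    have "summable (\<lambda>j. if i < j then cmod (w j * x j) else 0)"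
    proof (rule summableI_nonneg_bounded)
      show "(\<Sum>j<n. if i < j then cmod (w j * x j) else 0) \<le> 4 * B * l2norm x" for n
      proof -
        have "(\<Sum>j<n. if i < j then cmod (w j * x j) else 0) \<le>
            (\<Sum>j\<le>n. if i < j then cmod (w j * x j) else 0)" by (intro sum_mono2) auto
        then show ?thesis using le[of n] unfolding sum_up_to_eq by linarith
      qed
    qed simp
    then show ?thesis by (rule summable_norm_cancel[OF summable_cong[THEN iffD1, rotated]]) auto
  qed
  then show "summable (\<lambda>j. if i < j then w j * x j else 0)" .
  have lim: "(\<lambda>J. \<Sum>j\<in>{i<..J}. w j * x j) \<longlonglongrightarrow> tri w x i" for i
    using summable_LIMSEQ'[OF sum[of i]] unfolding sum_up_to_eq tri_def .
  have "(\<Sum>i<N. (cmod (tri w x i))^2) \<le> (4 * B * l2norm x)^2" for N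
  proof (rule LIMSEQ_le_const2)
    show "(\<lambda>J. \<Sum>i<N. (cmod (\<Sum>j\<in>{i<..J}. w j * x j))^2) \<longlonglongrightarrow> (\<Sum>i<N. (cmod (tri w x i))^2)"
      by (intro tendsto_intros lim)
    have "(\<Sum>i<N. (cmod (\<Sum>j\<in>{i<..J}. w j * x j))^2) \<le> (4 * B * l2norm x)^2" for J
      by (rule order_trans[OF _ tri_truncated_bound[OF assms, of J N]])
        (intro sum_mono power_mono norm_sum norm_ge_zero)
    then show "\<exists>M. \<forall>J\<ge>M. (\<Sum>i<N. (cmod (\<Sum>j\<in>{i<..J}. w j * x j))^2) \<le> (4 * B * l2norm x)^2"
      by blast
  qed
  from ell2_bounded_sums[OF this C]
  show "tri w x \<in> ell2" "l2norm (tri w x) \<le> 4 * B * l2norm x" .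
qed

definition dtri :: "(nat \<Rightarrow> complex) \<Rightarrow> (nat \<Rightarrow> complex) \<Rightarrow> (nat \<Rightarrow> complex) \<Rightarrow> nat \<Rightarrow> complex" where
  "dtri a w x i = a i * x i + tri w x i"

lemma diag_bounded:
  assumes "\<And>i. cmod (a i) \<le> A" "x \<in> ell2"
  shows diag_ell2: "(\<lambda>i. a i * x i) \<in> ell2"
    and l2norm_diag_le: "l2norm (\<lambda>i. a i * x i) \<le> A * l2norm x"
proof -
  have A: "0 \<le> A" using assms(1) norm_ge_zero order_trans by blast
  have "(\<Sum>i<n. (cmod (a i * x i))^2) \<le> (A * l2norm x)^2" for n
  proof -
    have "(\<Sum>i<n. (cmod (a i * x i))^2) \<le> (\<Sum>i<n. A^2 * (cmod (x i))^2)"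
      unfolding norm_mult power_mult_distrib
      by (intro sum_mono mult_right_mono power_mono assms) auto
    also have "\<dots> = A^2 * (\<Sum>i<n. (cmod (x i))^2)" by (simp add: sum_distrib_left)
    also have "\<dots> \<le> A^2 * (l2norm x)^2"
      by (intro mult_left_mono sum_le_l2norm_power2 assms) auto
    finally show ?thesis by (simp add: power_mult_distrib)
  qed
  from ell2_bounded_sums[OF this] A assms(2)
  show "(\<lambda>i. a i * x i) \<in> ell2" "l2norm (\<lambda>i. a i * x i) \<le> A * l2norm x" by auto
qed

lemma dtri_bounded:
  assumes "\<And>i. cmod (a i) \<le> A" "\<And>n. blk w n \<le> B^2" "cmod (w 1) \<le> B" "x \<in> ell2"
  shows dtri_ell2: "dtri a w x \<in> ell2"
    and l2norm_dtri_le: "l2norm (dtri a w x) \<le> (A + 4 * B) * l2norm x"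
proof -
  have eq: "dtri a w x = (\<lambda>i. a i * x i + tri w x i)" by (auto simp: dtri_def)
  show "dtri a w x \<in> ell2"
    unfolding eq by (intro ell2_add diag_ell2[OF assms(1,4)] tri_ell2[OF assms(2-4)])
  have "l2norm (dtri a w x) \<le> l2norm (\<lambda>i. a i * x i) + l2norm (tri w x)"
    unfolding eq by (intro l2norm_add diag_ell2[OF assms(1,4)] tri_ell2[OF assms(2-4)])
  also have "\<dots> \<le> A * l2norm x + 4 * B * l2norm x"
    by (intro add_mono l2norm_diag_le[OF assms(1,4)] l2norm_tri_le[OF assms(2-4)])
  finally show "l2norm (dtri a w x) \<le> (A + 4 * B) * l2norm x" by (simp add: algebra_simps)
qed

section \<open>The matrix as diagonal plus triangular part; test vectors and the boundedness
  criterion\<close>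

definition incr :: "(nat \<Rightarrow> complex) \<Rightarrow> nat \<Rightarrow> complex" where
  "incr c j = c j - c (j - 1)"

lemma dyadic_block_eq: "dyadic_block c n = blk (incr c) n"
proof -
  have "{2^n<..2^(n+1)} = {Suc (2^n)..<Suc (2^(n+1))}" by auto
  then show ?thesis
    unfolding dyadic_block_def blk_def incr_def
    by (simp only: sum.shift_bounds_Suc_ivl) (simp add: norm_minus_commute)
qed

lemma Tmat_mult: "Tmat c i j * x j = (if j = i then c i * x i else 0) + (if i < j then incr c j * x j else 0)"
  by (auto simp: Tmat_def incr_def)

lemma Tmat_sums:
  assumes "summable (\<lambda>j. if i < j then incr c j * x j else 0)"
  shows "(\<lambda>j. Tmat c i j * x j) sums dtri c (incr c) x i"
  unfolding Tmat_mult dtri_def tri_def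
  by (intro sums_add sums_single[of i "\<lambda>j. c i * x i"] summable_sums assms)

lemma mat_apply_Tmat:
  assumes "summable (\<lambda>j. if i < j then incr c j * x j else 0)"
  shows "mat_apply (Tmat c) x i = dtri c (incr c) x i"
  using Tmat_sums[OF assms] unfolding mat_apply_def by (simp add: sums_iff)

lemma mat_apply_Tmat_finite:
  assumes "finite F" "\<And>j. j \<notin> F \<Longrightarrow> x j = 0"
  shows "mat_apply (Tmat c) x = dtri c (incr c) x"
  by (intro ext mat_apply_Tmat summable_finite[OF assms(1)]) (use assms(2) in auto)

definition unitv :: "nat \<Rightarrow> nat \<Rightarrow> complex" where
  "unitv k i = (if i = k then 1 else 0)"

lemma unitv_ell2 [simp]: "unitv k \<in> ell2"
  by (rule ell2_finite_support[of "{k}"]) (auto simp: unitv_def)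

lemma l2norm_unitv [simp]: "l2norm (unitv k) = 1"
proof -
  have "(l2norm (unitv k))^2 = 1"
    using l2norm_finite_support[of "{k}" "unitv k"] by (auto simp: unitv_def)
  then show ?thesis using l2norm_nonneg[OF unitv_ell2, of k] by (simp add: power2_eq_1_iff)
qed

lemma tri_finite_support:
  assumes "finite F" "\<And>j. j \<notin> F \<Longrightarrow> w j * x j = 0"
  shows "tri w x i = (\<Sum>j\<in>F. if i < j then w j * x j else 0)"
  unfolding tri_def by (rule suminf_finite[OF assms(1)]) (use assms(2) in auto)

lemma mat_apply_unitv:
  "mat_apply (Tmat c) (unitv k) i = (if i = k then c k else if i < k then incr c k else 0)"
proof -
  have "tri (incr c) (unitv k) i = (\<Sum>j\<in>{k}. if i < j then incr c j * unitv k j else 0)"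
    by (rule tri_finite_support) (auto simp: unitv_def)
  then show ?thesis
    by (subst mat_apply_Tmat_finite[of "{k}"]) (auto simp: unitv_def dtri_def)
qed

definition blksq :: "(nat \<Rightarrow> complex) \<Rightarrow> nat \<Rightarrow> real" where
  "blksq w n = (\<Sum>j\<in>{2^n<..2^(n+1)}. (cmod (w j))^2)"

lemma blk_eq: "blk w n = 2^n * blksq w n"
  by (simp add: blk_def blksq_def)

lemma blksq_nonneg [simp]: "0 \<le> blksq w n"
  unfolding blksq_def by (simp add: sum_nonneg)

lemma blk_nonneg [simp]: "0 \<le> blk w n"
  unfolding blk_eq by simp

text \<open>If the block vanishes, division by zero makes this the zero vector.\<close>

definition blkv :: "(nat \<Rightarrow> complex) \<Rightarrow> nat \<Rightarrow> nat \<Rightarrow> complex" where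
  "blkv w n j = (if j \<in> {2^n<..2^(n+1)} then cnj (w j) / sqrt (blksq w n) else 0)"

lemma blkv_support: "j \<notin> {2^n<..2^(n+1)} \<Longrightarrow> blkv w n j = 0"
  unfolding blkv_def by (rule if_not_P)

lemma blkv_ell2 [simp]: "blkv w n \<in> ell2"
  by (rule ell2_finite_support[of "{2^n<..2^(n+1)}"]) (auto simp: blkv_def)

lemma l2norm_blkv_le: "l2norm (blkv w n) \<le> 1"
proof -
  have "(l2norm (blkv w n))^2 = (\<Sum>j\<in>{2^n<..2^(n+1)}. (cmod (blkv w n j))^2)"
    by (rule l2norm_finite_support) (auto simp: blkv_def)
  also have "\<dots> = (\<Sum>j\<in>{2^n<..2^(n+1)}. (cmod (w j))^2 / blksq w n)"
    by (intro sum.cong refl) (auto simp: blkv_def norm_divide power_divide)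
  also have "\<dots> = blksq w n / blksq w n"
    by (simp only: sum_divide_distrib[symmetric] blksq_def)
  also have "\<dots> \<le> 1" by simp
  finally show ?thesis using l2norm_nonneg[OF blkv_ell2, of w n] by (simp add: abs_square_le_1)
qed

text \<open>Rows up to \<open>2^n\<close> lie above the whole block, so each of them pairs the block
  with its own normalised conjugate; the diagonal contributes nothing because \<open>blkv\<close>
  vanishes at \<open>i\<close>.\<close>

lemma mat_apply_blkv:
  assumes "i \<le> 2^n"
  shows "mat_apply (Tmat c) (blkv (incr c) n) i = sqrt (blksq (incr c) n)"
proof -
  define S where "S = blksq (incr c) n"
  have "tri (incr c) (blkv (incr c) n) i =
      (\<Sum>j\<in>{2^n<..2^(n+1)}. if i < j then incr c j * blkv (incr c) n j else 0)"
    by (rule tri_finite_support) (auto simp: blkv_def)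
  also have "\<dots> = (\<Sum>j\<in>{2^n<..2^(n+1)}. complex_of_real ((cmod (incr c j))^2) / sqrt S)"
    using assms
    by (intro sum.cong refl) (auto simp: blkv_def S_def complex_norm_square[unfolded of_real_power])
  also have "\<dots> = of_real (S / sqrt S)"
    by (simp add: S_def blksq_def sum_divide_distrib)
  also have "S / sqrt S = sqrt S" by (simp add: S_def real_div_sqrt)
  finally have "tri (incr c) (blkv (incr c) n) i = sqrt S" .
  moreover have "blkv (incr c) n i = 0" using assms by (simp add: blkv_def)
  ultimately show ?thesis
    by (subst mat_apply_Tmat_finite[of "{2^n<..2^(n+1)}"]) (auto simp: blkv_def dtri_def S_def)
qed

text \<open>The \<open>2^n\<close> rows \<open>i < 2^n\<close> carry equal entries, which reproduces
  the factor \<open>2^n\<close> exactly.\<close>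

lemma blk_le_mat_apply_blkv:
  assumes "mat_apply (Tmat c) (blkv (incr c) n) \<in> ell2"
  shows "blk (incr c) n \<le> (l2norm (mat_apply (Tmat c) (blkv (incr c) n)))^2"
proof -
  have "blk (incr c) n = (\<Sum>i<(2::nat)^n. (cmod (mat_apply (Tmat c) (blkv (incr c) n) i))^2)"
    by (simp add: mat_apply_blkv blk_eq)
  also have "\<dots> \<le> (l2norm (mat_apply (Tmat c) (blkv (incr c) n)))^2"
    by (rule sum_le_l2norm_power2[OF assms]) simp
  finally show ?thesis .
qed

text \<open>The hypotheses of the Schur test bundled with a bound for the diagonal. Column 1 has its
  own clause because no block contains it.\<close>

definition coeffs_le :: "real \<Rightarrow> real \<Rightarrow> (nat \<Rightarrow> complex) \<Rightarrow> (nat \<Rightarrow> complex) \<Rightarrow> bool" where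
  "coeffs_le A B a w \<longleftrightarrow> (\<forall>i. cmod (a i) \<le> A) \<and> (\<forall>n. blk w n \<le> B^2) \<and> cmod (w 1) \<le> B"

lemma coeffs_leD:
  assumes "coeffs_le A B a w" "x \<in> ell2"
  shows "summable (\<lambda>j. if i < j then w j * x j else 0)" "dtri a w x \<in> ell2"
    "l2norm (dtri a w x) \<le> (A + 4 * B) * l2norm x"
  using assms unfolding coeffs_le_def
  by (auto intro: summable_tri dtri_ell2 l2norm_dtri_le)

lemma coeffs_le_Tmat:
  assumes "coeffs_le A B c (incr c)" "x \<in> ell2"
  shows "mat_apply (Tmat c) x = dtri c (incr c) x"
  by (intro ext mat_apply_Tmat coeffs_leD(1)[OF assms])

lemma coeffs_le_matrix_bounded:
  assumes "coeffs_le A B c (incr c)"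
  shows "matrix_bounded (Tmat c)"
  unfolding matrix_bounded_def
proof (intro exI ballI conjI allI)
  fix x i assume x: "x \<in> ell2"
  show "summable (\<lambda>j. Tmat c i j * x j)"
    using Tmat_sums[OF coeffs_leD(1)[OF assms x]] by (rule sums_summable)
  show "mat_apply (Tmat c) x \<in> ell2" "l2norm (mat_apply (Tmat c) x) \<le> (A + 4 * B) * l2norm x"
    unfolding coeffs_le_Tmat[OF assms x] by (intro coeffs_leD[OF assms x])+
qed

lemma bdd_coeffs_le:
  assumes "bdd_above (range (\<lambda>k. cmod (c k)))" "bdd_above (range (dyadic_block c))"
  obtains A B where "coeffs_le A B c (incr c)"
proof -
  obtain A D where A: "\<And>k. cmod (c k) \<le> A" and D: "\<And>n. blk (incr c) n \<le> D"
    using assms by (auto simp: bdd_above_def dyadic_block_eq)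
  \<comment> \<open>The second summand makes \<open>B\<close> dominate column 1 as well.\<close>
  define B where "B = sqrt D + cmod (incr c 1)"
  have D0: "0 \<le> D" using D[of 0] blk_nonneg[of "incr c" 0] by linarith
  have "D \<le> B^2" using power_mono[of "sqrt D" B 2] D0 by (simp add: B_def)
  then have "blk (incr c) n \<le> B^2" for n using D[of n] by linarith
  moreover have "cmod (incr c 1) \<le> B" using D0 by (simp add: B_def)
  ultimately show ?thesis using that[of A B] A by (simp add: coeffs_le_def)
qed

theorem matrix_bounded_Tmat_iff:
  "matrix_bounded (Tmat c) \<longleftrightarrow>
     bdd_above (range (\<lambda>k. cmod (c k))) \<and> bdd_above (range (dyadic_block c))"
proof
  assume "matrix_bounded (Tmat c)"
  then obtain C where C: "\<And>x. x \<in> ell2 \<Longrightarrow> mat_apply (Tmat c) x \<in> ell2"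
    "\<And>x. x \<in> ell2 \<Longrightarrow> l2norm (mat_apply (Tmat c) x) \<le> C * l2norm x"
    unfolding matrix_bounded_def by blast
  have "cmod (c k) \<le> C" for k
    using cmod_le_l2norm[OF C(1)[OF unitv_ell2], of k k] C(2)[OF unitv_ell2, of k]
    by (simp add: mat_apply_unitv)
  moreover have "dyadic_block c n \<le> C^2" for n
  proof -
    have C0: "0 \<le> C" using C(2)[of "unitv 0"] l2norm_nonneg[OF C(1)[of "unitv 0"]] by simp
    let ?u = "blkv (incr c) n"
    have "l2norm (mat_apply (Tmat c) ?u) \<le> C * 1"
      using C(2)[of ?u] mult_left_mono[OF l2norm_blkv_le C0, of "incr c" n] by simp
    then have "(l2norm (mat_apply (Tmat c) ?u))^2 \<le> C^2" using C(1)[of ?u]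
      by (intro power_mono) auto
    then show ?thesis
      using blk_le_mat_apply_blkv[of c n] C(1)[of ?u] by (simp add: dyadic_block_eq)
  qed
  ultimately show "bdd_above (range (\<lambda>k. cmod (c k))) \<and> bdd_above (range (dyadic_block c))"
    by (auto simp: bdd_above_def)
next
  assume "bdd_above (range (\<lambda>k. cmod (c k))) \<and> bdd_above (range (dyadic_block c))"
  then show "matrix_bounded (Tmat c)" using bdd_coeffs_le coeffs_le_matrix_bounded by metis
qed

subsection \<open>Compactness\<close>

text \<open>Plays the role of "compact operators turn weak into norm convergence". If the norms
  stayed above some \<open>e\<close> along a subsequence, a further subsequence would converge in
  norm; its limit vanishes coordinatewise, a contradiction.\<close>

lemma matrix_compact_null_sequence:
  assumes "matrix_compact M" "\<And>n. ws n \<in> ell2" "\<And>n. l2norm (ws n) \<le> K"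
    and null: "\<And>i. (\<lambda>n. mat_apply M (ws n) i) \<longlonglongrightarrow> 0"
  shows "(\<lambda>n. l2norm (mat_apply M (ws n))) \<longlonglongrightarrow> 0"
proof (rule ccontr)
  have "matrix_bounded M" using assms(1) by (simp add: matrix_compact_def)
  then have ell: "mat_apply M (ws n) \<in> ell2" for n
    using assms(2) unfolding matrix_bounded_def by blast
  assume "\<not> ?thesis"
  then obtain e where e: "e > 0"
    "\<not> (\<forall>\<^sub>F n in sequentially. dist (l2norm (mat_apply M (ws n))) 0 < e)"
    unfolding tendsto_iff by blast
  then have "\<not> (\<forall>\<^sub>F n in sequentially. l2norm (mat_apply M (ws n)) < e)"
    using l2norm_nonneg[OF ell] by simp
  then have "infinite {n. e \<le> l2norm (mat_apply M (ws n))}"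
    unfolding frequently_cofinite[symmetric] cofinite_eq_sequentially
    by (simp add: frequently_def not_le)
  then obtain s :: "nat \<Rightarrow> nat" where s: "strict_mono s" "\<And>n. e \<le> l2norm (mat_apply M (ws (s n)))"
    using infinite_enumerate[of "{n. e \<le> l2norm (mat_apply M (ws n))}"] by blast
  have "bdd_above (range (\<lambda>n. l2norm (ws (s n))))" using assms(3) by (auto simp: bdd_above_def)
  then obtain r y where ry: "strict_mono r" "y \<in> ell2"
    "(\<lambda>n. l2norm (\<lambda>i. mat_apply M (ws (s (r n))) i - y i)) \<longlonglongrightarrow> 0"
    using assms(1)[unfolded matrix_compact_def, THEN conjunct2, THEN spec, of "\<lambda>n. ws (s n)"] assms(2)
    by (elim impE) auto
  have "y i = 0" for i
  proof -
    have "(\<lambda>n. mat_apply M (ws (s (r n))) i - y i) \<longlonglongrightarrow> 0"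
    proof (rule Lim_null_comparison[OF _ ry(3)])
      show "\<forall>\<^sub>F n in sequentially. cmod (mat_apply M (ws (s (r n))) i - y i) \<le>
          l2norm (\<lambda>i. mat_apply M (ws (s (r n))) i - y i)"
        by (intro always_eventually allI cmod_le_l2norm ell2_diff ell ry(2))
    qed
    moreover have "(\<lambda>n. mat_apply M (ws (s (r n))) i - y i) \<longlonglongrightarrow> 0 - y i"
      using LIMSEQ_subseq_LIMSEQ[OF null[of i] strict_mono_o[OF s(1) ry(1)]]
      by (intro tendsto_diff) (auto simp: o_def)
    ultimately show ?thesis using LIMSEQ_unique by fastforce
  qed
  then have "(\<lambda>n. l2norm (mat_apply M (ws (s (r n))))) \<longlonglongrightarrow> 0" using ry(3) by simp
  then have "e \<le> 0" by (rule LIMSEQ_le_const) (use s(2) in auto)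
  then show False using e(1) by simp
qed

lemma matrix_compact_Tmat_imp:
  assumes "matrix_compact (Tmat c)"
  shows "(\<lambda>k. cmod (c k)) \<longlonglongrightarrow> 0" "dyadic_block c \<longlonglongrightarrow> 0"
proof -
  have b: "matrix_bounded (Tmat c)" using assms by (simp add: matrix_compact_def)
  then obtain C where C: "\<And>x. x \<in> ell2 \<Longrightarrow> mat_apply (Tmat c) x \<in> ell2"
    "\<And>x. x \<in> ell2 \<Longrightarrow> l2norm (mat_apply (Tmat c) x) \<le> C * l2norm x"
    unfolding matrix_bounded_def by blast
  obtain D where D: "\<And>n. blk (incr c) n \<le> D"
    using b unfolding matrix_bounded_Tmat_iff by (auto simp: bdd_above_def dyadic_block_eq)
  \<comment> \<open>Needed for coordinatewise convergence: column \<open>k\<close> repeats the entry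
    \<open>incr c k\<close> in its \<open>k\<close> rows above the diagonal, so boundedness alone
    forces decay like \<open>1 / sqrt k\<close>.\<close>
  have incr_le: "cmod (incr c k) \<le> C / sqrt k" if "k > 0" for k
  proof -
    have "real k * (cmod (incr c k))^2 = (\<Sum>i<k. (cmod (mat_apply (Tmat c) (unitv k) i))^2)"
      by (simp add: mat_apply_unitv)
    also have "\<dots> \<le> (l2norm (mat_apply (Tmat c) (unitv k)))^2"
      by (intro sum_le_l2norm_power2 C) auto
    also have "\<dots> \<le> C^2" using C[of "unitv k"] by (intro power_mono) auto
    finally have "(sqrt k * cmod (incr c k))^2 \<le> C^2" by (simp add: power_mult_distrib)
    moreover have "0 \<le> C" using C(2)[of "unitv 0"] l2norm_nonneg[OF C(1)[of "unitv 0"]] by simp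
    ultimately have "sqrt k * cmod (incr c k) \<le> C" by (rule power2_le_imp_le)
    then show ?thesis using that by (simp add: field_simps)
  qed
  have "(\<lambda>k. l2norm (mat_apply (Tmat c) (unitv k))) \<longlonglongrightarrow> 0"
  proof (rule matrix_compact_null_sequence[OF assms, of _ 1])
    fix i
    have "(\<lambda>k. C / sqrt (real k)) \<longlonglongrightarrow> 0" by real_asymp
    then show "(\<lambda>k. mat_apply (Tmat c) (unitv k) i) \<longlonglongrightarrow> 0"
    proof (rule Lim_null_comparison[rotated])
      show "\<forall>\<^sub>F k in sequentially. cmod (mat_apply (Tmat c) (unitv k) i) \<le> C / sqrt (real k)"
        using eventually_gt_at_top[of i] by eventually_elim (auto simp: mat_apply_unitv incr_le)
    qed
  qed auto
  then show "(\<lambda>k. cmod (c k)) \<longlonglongrightarrow> 0"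
  proof (rule Lim_null_comparison[rotated])
    show "\<forall>\<^sub>F k in sequentially. norm (cmod (c k)) \<le> l2norm (mat_apply (Tmat c) (unitv k))"
      using cmod_le_l2norm[OF C(1)[OF unitv_ell2], of k k for k]
      by (intro always_eventually allI) (simp add: mat_apply_unitv)
  qed
  have "(\<lambda>n. l2norm (mat_apply (Tmat c) (blkv (incr c) n))) \<longlonglongrightarrow> 0"
  proof (rule matrix_compact_null_sequence[OF assms, of _ 1])
    fix i
    \<comment> \<open>For \<open>n\<close> large, row \<open>i\<close> of the image is
      \<open>sqrt (blksq (incr c) n)\<close>, and bounded \<open>blk\<close> makes this at most
      \<open>sqrt (D / 2^n)\<close>.\<close>
    have "(\<lambda>n. sqrt (D / 2^n)) \<longlonglongrightarrow> sqrt 0"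
      by (intro tendsto_real_sqrt) real_asymp
    then have "(\<lambda>n. sqrt (D / 2^n)) \<longlonglongrightarrow> 0" by simp
    then show "(\<lambda>n. mat_apply (Tmat c) (blkv (incr c) n) i) \<longlonglongrightarrow> 0"
    proof (rule Lim_null_comparison[rotated])
      show "\<forall>\<^sub>F n in sequentially. cmod (mat_apply (Tmat c) (blkv (incr c) n) i) \<le> sqrt (D / 2^n)"
        using eventually_ge_at_top[of i]
      proof eventually_elim
        case (elim n)
        then have "i \<le> 2^n" using less_exp[of n] by linarith
        moreover have "blksq (incr c) n \<le> D / 2^n" using D[of n] by (simp add: blk_eq field_simps)
        ultimately show ?case by (simp add: mat_apply_blkv)
      qed
    qed
  qed (auto simp: l2norm_blkv_le)
  then have "(\<lambda>n. (l2norm (mat_apply (Tmat c) (blkv (incr c) n)))^2) \<longlonglongrightarrow> 0"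
    using tendsto_power[of _ 0 sequentially 2] by simp
  then show "dyadic_block c \<longlonglongrightarrow> 0"
    by (rule Lim_null_comparison[rotated])
      (intro always_eventually allI, simp add: dyadic_block_eq blk_le_mat_apply_blkv C)
qed

section \<open>Splitting of coefficients, and sufficiency for compactness\<close>

lemma dtri_add_coeffs:
  assumes "coeffs_le A B a w" "coeffs_le A' B' a' w'" "x \<in> ell2"
  shows "dtri (\<lambda>i. a i + a' i) (\<lambda>i. w i + w' i) x = (\<lambda>i. dtri a w x i + dtri a' w' x i)"
proof
  fix i
  have "tri (\<lambda>i. w i + w' i) x i = tri w x i + tri w' x i"
    unfolding tri_def suminf_add[OF coeffs_leD(1)[OF assms(1,3)] coeffs_leD(1)[OF assms(2,3)]]
    by (intro suminf_cong) (auto simp: algebra_simps)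
  then show "dtri (\<lambda>i. a i + a' i) (\<lambda>i. w i + w' i) x i = dtri a w x i + dtri a' w' x i"
    by (simp add: dtri_def algebra_simps)
qed

lemma dtri_diff_vector:
  assumes "coeffs_le A B a w" "x \<in> ell2" "y \<in> ell2"
  shows "dtri a w (\<lambda>i. x i - y i) = (\<lambda>i. dtri a w x i - dtri a w y i)"
proof
  fix i
  have "tri w (\<lambda>i. x i - y i) i = tri w x i - tri w y i"
    unfolding tri_def suminf_diff[OF coeffs_leD(1)[OF assms(1,2)] coeffs_leD(1)[OF assms(1,3)]]
    by (intro suminf_cong) (auto simp: algebra_simps)
  then show "dtri a w (\<lambda>i. x i - y i) i = dtri a w x i - dtri a w y i"
    by (simp add: dtri_def algebra_simps)
qed

definition head :: "nat \<Rightarrow> (nat \<Rightarrow> complex) \<Rightarrow> nat \<Rightarrow> complex" where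
  "head N a i = (if i \<le> N then a i else 0)"

definition tail :: "nat \<Rightarrow> (nat \<Rightarrow> complex) \<Rightarrow> nat \<Rightarrow> complex" where
  "tail N a i = (if i \<le> N then 0 else a i)"

lemma blk_mono:
  assumes "\<And>j. cmod (v j) \<le> cmod (w j)"
  shows "blk v n \<le> blk w n"
  unfolding blk_def by (intro mult_left_mono sum_mono power_mono assms) auto

lemma coeffs_le_head: "coeffs_le A B a w \<Longrightarrow> coeffs_le A B (head N a) (head N w)"
  unfolding coeffs_le_def
  using order_trans[OF blk_mono[of "head N w" w]] order_trans[OF norm_ge_zero, of "a _" A]
    order_trans[OF norm_ge_zero, of "w 1" B]
  by (auto simp: head_def)

text \<open>Cutting at a power of two removes the blocks below \<open>m\<close> completely and
  leaves the others whole. It also removes column 1, so the clause for \<open>w 1\<close> holds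
  trivially.\<close>

lemma coeffs_le_tail:
  assumes "e \<ge> 0" "\<And>k. k \<ge> m \<Longrightarrow> cmod (a k) \<le> e" "\<And>n. n \<ge> m \<Longrightarrow> blk w n \<le> e^2"
  shows "coeffs_le e e (tail (2^m) a) (tail (2^m) w)"
proof -
  have "blk (tail (2^m) w) n \<le> e^2" for n
  proof (cases "m \<le> n")
    case True
    then show ?thesis
      using order_trans[OF blk_mono[of "tail (2^m) w" w n] assms(3)[of n]] by (auto simp: tail_def)
  next
    case False
    then have "(2::nat)^(n+1) \<le> 2^m" by (intro power_increasing) auto
    then have "blksq (tail (2^m) w) n = 0" unfolding blksq_def by (intro sum.neutral) (auto simp: tail_def)
    then show ?thesis by (simp add: blk_eq)
  qed
  moreover have "cmod (tail (2^m) a k) \<le> e" for k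
  proof (cases "k \<le> 2^m")
    case False
    then have "m \<le> k" using less_exp[of m] by linarith
    then show ?thesis using assms by (simp add: tail_def)
  qed (simp add: tail_def assms)
  ultimately show ?thesis using assms(1) by (simp add: coeffs_le_def tail_def)
qed

text \<open>The head is a matrix with finitely many nonzero rows and columns, for which
  coordinatewise convergence suffices.\<close>

lemma dtri_head_tendsto_0:
  assumes "\<And>i. (\<lambda>n. z n i) \<longlonglongrightarrow> 0"
  shows "(\<lambda>n. l2norm (dtri (head N a) (head N w) (z n))) \<longlonglongrightarrow> 0"
proof -
  have t: "tri (head N w) y i = (\<Sum>j\<in>{..N}. if i < j then head N w j * y j else 0)" for y i
    by (rule tri_finite_support) (auto simp: head_def)
  have "(l2norm (dtri (head N a) (head N w) y))^2 = (\<Sum>i\<le>N. (cmod (dtri (head N a) (head N w) y i))^2)" for y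
    by (rule l2norm_finite_support) (auto simp: dtri_def t head_def intro!: sum.neutral)
  moreover have "dtri (head N a) (head N w) y \<in> ell2" for y
    by (rule ell2_finite_support[of "{..N}"]) (auto simp: dtri_def t head_def intro!: sum.neutral)
  ultimately have eq: "l2norm (dtri (head N a) (head N w) y) =
      sqrt (\<Sum>i\<le>N. (cmod (dtri (head N a) (head N w) y i))^2)" for y
    by (metis l2norm_nonneg real_sqrt_abs abs_of_nonneg)
  have "(\<lambda>n. dtri (head N a) (head N w) (z n) i) \<longlonglongrightarrow> 0" for i
  proof -
    have "(\<lambda>n. if i < j then head N w j * z n j else 0) \<longlonglongrightarrow> 0" for j
      using tendsto_mult_right_zero[OF assms[of j], of "head N w j"] by (cases "i < j") auto
    then have "(\<lambda>n. head N a i * z n i + (\<Sum>j\<in>{..N}. if i < j then head N w j * z n j else 0))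
       \<longlonglongrightarrow> head N a i * 0 + (\<Sum>j\<in>{..N}. 0)"
      by (intro tendsto_intros assms)
    then show ?thesis by (simp add: dtri_def t)
  qed
  then have "(\<lambda>n. sqrt (\<Sum>i\<le>N. (cmod (dtri (head N a) (head N w) (z n) i))^2)) \<longlonglongrightarrow>
      sqrt (\<Sum>i\<le>N. (cmod 0)^2)"
    by (intro tendsto_intros)
  then show ?thesis unfolding eq by simp
qed

lemma coeffs_tendsto_0_le:
  assumes "(\<lambda>k. cmod (c k)) \<longlonglongrightarrow> 0" "dyadic_block c \<longlonglongrightarrow> 0"
  obtains A B where "coeffs_le A B c (incr c)"
proof -
  have "bdd_above (range (\<lambda>k. cmod (c k)))" "bdd_above (range (dyadic_block c))"
    by (rule bounded_imp_bdd_above, rule convergent_imp_bounded, rule assms)+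
  then show ?thesis using bdd_coeffs_le that by metis
qed

text \<open>A bounded sequence has a coordinatewise convergent subsequence whose limit is again in
  \<open>ell2\<close>. On the differences from that limit the head tends to zero, while the tail has
  uniformly small norm.\<close>

lemma matrix_compact_TmatI:
  assumes "(\<lambda>k. cmod (c k)) \<longlonglongrightarrow> 0" "dyadic_block c \<longlonglongrightarrow> 0"
  shows "matrix_compact (Tmat c)"
  unfolding matrix_compact_def
proof (intro conjI allI impI)
  obtain A B where AB: "coeffs_le A B c (incr c)" using coeffs_tendsto_0_le[OF assms] .
  show "matrix_bounded (Tmat c)" by (rule coeffs_le_matrix_bounded[OF AB])
  fix xs :: "nat \<Rightarrow> nat \<Rightarrow> complex"
  assume *: "(\<forall>n. xs n \<in> ell2) \<and> bdd_above (range (\<lambda>n. l2norm (xs n)))"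
  then have xs: "\<forall>n. xs n \<in> ell2" by blast
  from * obtain K where K: "\<And>n. l2norm (xs n) \<le> K" by (auto simp: bdd_above_def)
  have K0: "0 \<le> K" using K[of 0] xs l2norm_nonneg order_trans by blast
  have "cmod (xs n i) \<le> K" for n i using K[of n] cmod_le_l2norm[of "xs n" i] xs by force
  \<comment> \<open>Diagonal argument over the countably many coordinates.\<close>
  then obtain r where r: "strict_mono (r::nat\<Rightarrow>nat)" "\<And>i. \<exists>l. (\<lambda>n. xs (r n) i) \<longlonglongrightarrow> l"
    using function_convergent_subsequence[of UNIV xs K] by (metis UNIV_I countableI_type)
  then obtain x where x: "\<And>i. (\<lambda>n. xs (r n) i) \<longlonglongrightarrow> x i" by metis
  have "(\<Sum>i<N. (cmod (x i))^2) \<le> K^2" for N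
  proof (rule LIMSEQ_le_const2)
    show "(\<lambda>n. \<Sum>i<N. (cmod (xs (r n) i))^2) \<longlonglongrightarrow> (\<Sum>i<N. (cmod (x i))^2)"
      by (intro tendsto_intros x)
    have "(\<Sum>i<N. (cmod (xs (r n) i))^2) \<le> K^2" for n
    proof -
      have "(l2norm (xs (r n)))^2 \<le> K^2" using K xs by (intro power_mono) auto
      then show ?thesis using sum_le_l2norm_power2[of "xs (r n)" "{..<N}"] xs by force
    qed
    then show "\<exists>M. \<forall>n\<ge>M. (\<Sum>i<N. (cmod (xs (r n) i))^2) \<le> K^2" by blast
  qed
  from ell2_bounded_sums[OF this K0] have xl: "x \<in> ell2" "l2norm x \<le> K" .
  define z where "z n = (\<lambda>i. xs (r n) i - x i)" for n
  have zl: "z n \<in> ell2" for n unfolding z_def using xs xl by (intro ell2_diff) auto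
  have zK: "l2norm (z n) \<le> 2 * K" for n
    using l2norm_diff[of "xs (r n)" x] xs xl K[of "r n"] by (force simp: z_def)
  have z0: "(\<lambda>n. z n i) \<longlonglongrightarrow> 0" for i unfolding z_def using tendsto_diff[OF x tendsto_const, of i "x i"] by simp
  have "(\<lambda>n. l2norm (dtri c (incr c) (z n))) \<longlonglongrightarrow> 0"
  proof (rule LIMSEQ_I)
    fix e :: real assume e: "0 < e"
    \<comment> \<open>The tail has norm at most \<open>d + 4 * d\<close> and the vectors have norm
      at most \<open>2 * K\<close>, so it contributes at most \<open>10 * K * d\<close>, which is
      below \<open>e / 2\<close>. The summand 1 covers \<open>K = 0\<close>.\<close>
    define d where "d = e / (2 * (10 * K + 1))"
    have d: "d > 0" using e K0 by (simp add: d_def)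
    have "\<forall>\<^sub>F k in sequentially. cmod (c k) < d \<and> dyadic_block c k < d^2"
      using order_tendstoD(2)[OF assms(1) d] order_tendstoD(2)[OF assms(2), of "d^2"] d
      by (simp add: eventually_conj_iff)
    then obtain m where m: "\<And>k. k \<ge> m \<Longrightarrow> cmod (c k) < d" "\<And>k. k \<ge> m \<Longrightarrow> blk (incr c) k < d^2"
      by (auto simp: eventually_sequentially dyadic_block_eq)
    define N where "N = (2::nat)^m"
    have tl: "coeffs_le d d (tail N c) (tail N (incr c))"
      unfolding N_def using m d by (intro coeffs_le_tail) (auto intro: less_imp_le)
    have hd: "coeffs_le A B (head N c) (head N (incr c))" by (rule coeffs_le_head[OF AB])
    have sp: "dtri c (incr c) (z n) = (\<lambda>i. dtri (head N c) (head N (incr c)) (z n) i +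
        dtri (tail N c) (tail N (incr c)) (z n) i)" for n
    proof -
      have "(\<lambda>i. head N a i + tail N a i) = a" for a by (auto simp: head_def tail_def)
      then show ?thesis using dtri_add_coeffs[OF hd tl zl, of n] by simp
    qed
    obtain M where M: "\<And>n. n \<ge> M \<Longrightarrow> l2norm (dtri (head N c) (head N (incr c)) (z n)) < e/2"
      using order_tendstoD(2)[OF dtri_head_tendsto_0[of z N c "incr c", OF z0], of "e/2"] e
      by (auto simp: eventually_sequentially)
    show "\<exists>M. \<forall>n\<ge>M. norm (l2norm (dtri c (incr c) (z n)) - 0) < e"
    proof (intro exI allI impI)
      fix n assume "M \<le> n"
      have "l2norm (dtri c (incr c) (z n)) \<le> l2norm (dtri (head N c) (head N (incr c)) (z n)) +
          l2norm (dtri (tail N c) (tail N (incr c)) (z n))"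
        unfolding sp by (intro l2norm_add coeffs_leD(2)[OF hd zl] coeffs_leD(2)[OF tl zl])
      also have "\<dots> \<le> e/2 + (d + 4 * d) * l2norm (z n)"
        using M[OF \<open>M \<le> n\<close>] coeffs_leD(3)[OF tl zl[of n]] by linarith
      also have "(d + 4 * d) * l2norm (z n) \<le> (d + 4 * d) * (2 * K)"
        using d zK by (intro mult_left_mono) auto
      also have "\<dots> < d * (10 * K + 1)" using d by (simp add: algebra_simps)
      also have "\<dots> = e/2" using K0 by (simp add: d_def field_simps)
      finally have "l2norm (dtri c (incr c) (z n)) < e" by simp
      then show "norm (l2norm (dtri c (incr c) (z n)) - 0) < e"
        using l2norm_nonneg[OF coeffs_leD(2)[OF AB zl], of n] by simp
    qed
  qed
  moreover have "dtri c (incr c) (z n) =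
      (\<lambda>i. mat_apply (Tmat c) (xs (r n)) i - mat_apply (Tmat c) x i)" for n
    using xs xl unfolding z_def by (simp add: dtri_diff_vector[OF AB] coeffs_le_Tmat[OF AB])
  moreover have "mat_apply (Tmat c) x \<in> ell2"
    using coeffs_le_Tmat[OF AB xl(1)] coeffs_leD(2)[OF AB xl(1)] by simp
  ultimately show "\<exists>r y. strict_mono r \<and> y \<in> ell2 \<and>
      (\<lambda>n. l2norm (\<lambda>i. mat_apply (Tmat c) (xs (r n)) i - y i)) \<longlonglongrightarrow> 0"
    using r(1) by auto
qed

subsection \<open>Dyadic levels of a sequence\<close>

lemma half_power_powr: "(1 / 2^l) powr s = (2 powr (-s)) ^ l" for s :: real
  by (simp add: powr_divide powr_power powr_minus powr_realpow[symmetric] powr_powr mult.commute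
      field_simps)

lemma two_powr_minus_less_1: "0 < s \<Longrightarrow> 2 powr (-s) < (1::real)"
  using powr_less_mono[of "-s" 0 2] by simp

lemma geometric_tail_le:
  fixes r :: real
  assumes "0 \<le> r" "r < 1"
  shows "(\<Sum>l\<in>{m..<n}. r^l) \<le> r^m / (1 - r)"
proof (cases "m \<le> n")
  case True
  then have "(\<Sum>l\<in>{m..<n}. r^l) * (1 - r) = r^m - r^n"
    by (induction n rule: dec_induct) (auto simp: distrib_right right_diff_distrib)
  also have "\<dots> \<le> r^m" using assms by simp
  finally show ?thesis using assms by (simp add: le_divide_eq)
qed (use assms in simp)

text \<open>The admissible levels start at the least \<open>m\<close> with
  \<open>1 / 2^m \<le> a\<close>; the geometric series from there on is comparable to its first
  term.\<close>

lemma sum_levels_le: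
  fixes a s :: real
  assumes "0 < a" "0 < s"
  shows "(\<Sum>l | l < L \<and> 1 / 2^l \<le> a. (1 / 2^l) powr s) \<le> a powr s / (1 - 2 powr (-s))"
proof -
  define r where "r = 2 powr (-s)"
  have r: "0 \<le> r" "r < 1" using two_powr_minus_less_1[OF assms(2)] by (simp_all add: r_def)
  obtain l where "(1/2)^l < a" using real_arch_pow_inv[of a "1/2"] assms by auto
  then have ex: "\<exists>l. 1 / 2^l \<le> a" by (auto simp: power_one_over intro: less_imp_le)
  define m where "m = (LEAST l. 1 / 2^l \<le> a)"
  have m: "1 / 2^m \<le> a" unfolding m_def using ex by (rule LeastI_ex)
  have "(\<Sum>l | l < L \<and> 1 / 2^l \<le> a. (1 / 2^l) powr s) \<le> (\<Sum>l\<in>{m..<L}. r^l)"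
    unfolding half_power_powr r_def by (intro sum_mono2) (auto simp: m_def intro: Least_le)
  also have "\<dots> \<le> r^m / (1 - r)" by (rule geometric_tail_le[OF r])
  also have "\<dots> \<le> a powr s / (1 - r)"
  proof (rule divide_right_mono)
    show "r^m \<le> a powr s" using powr_mono2[OF _ _ m, of s] assms by (simp add: half_power_powr r_def)
  qed (use r in simp)
  finally show ?thesis by (simp add: r_def)
qed

lemma finite_level:
  fixes a :: "nat \<Rightarrow> real"
  assumes "summable (\<lambda>k. a k powr q)" "0 < q" "0 < t"
  shows "finite {k. t \<le> a k}"
proof -
  have "\<forall>\<^sub>F k in sequentially. a k powr q < t powr q"
    using order_tendstoD(2)[OF summable_LIMSEQ_zero[OF assms(1)], of "t powr q"] assms by simp
  then have "\<forall>\<^sub>F k in cofinite. \<not> t \<le> a k"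
    unfolding cofinite_eq_sequentially
    by eventually_elim (use assms powr_mono2[of q t] in force)
  then show ?thesis by (simp add: eventually_cofinite)
qed

text \<open>A discrete layer-cake formula: after exchanging the sums, index \<open>k\<close> meets
  exactly the levels below \<open>a k\<close>, and these add up to a multiple of
  \<open>a k powr (q - \<theta>)\<close>. The case \<theta> = 0 counts indices; \<theta> = 1 serves
  the block ranks and is where q > 1 is used.\<close>

lemma summable_levels:
  fixes a :: "nat \<Rightarrow> real"
  assumes "summable (\<lambda>k. a k powr q)" "\<And>k. 0 \<le> a k" "0 \<le> \<theta>" "\<theta> < q"
  shows "summable (\<lambda>l. (\<Sum>k | 1 / 2^l \<le> a k. a k powr \<theta>) * (1 / 2^l) powr (q - \<theta>))"
proof (rule summableI_nonneg_bounded)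
  fix L
  define s where "s = q - \<theta>"
  have s: "0 < s" using assms by (simp add: s_def)
  define c where "c = 1 / (1 - 2 powr (-s))"
  have c: "0 \<le> c" using two_powr_minus_less_1[OF s] by (simp add: c_def)
  have fin: "finite {k. 1 / 2^l \<le> a k}" for l
    using assms by (intro finite_level[of a q]) auto
  \<comment> \<open>All indices that occur in the first \<open>L\<close> levels; a finite set, so
    that the two sums can be exchanged.\<close>
  define F where "F = (\<Union>l<L. {k. 1 / 2^l \<le> a k})"
  have F: "finite F" unfolding F_def using fin by blast
  have Fpos: "0 < a k" if k: "k \<in> F" for k
  proof -
    obtain l where "1 / 2^l \<le> a k" using k unfolding F_def by blast
    then show ?thesis by (rule less_le_trans[rotated]) simp
  qed
  have "(\<Sum>l<L. (\<Sum>k | 1 / 2^l \<le> a k. a k powr \<theta>) * (1 / 2^l) powr s) =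
      (\<Sum>l<L. \<Sum>k | k \<in> F \<and> 1 / 2^l \<le> a k. a k powr \<theta> * (1 / 2^l) powr s)"
    unfolding sum_distrib_right by (intro sum.cong refl) (auto simp: F_def)
  also have "\<dots> = (\<Sum>k\<in>F. \<Sum>l | l \<in> {..<L} \<and> 1 / 2^l \<le> a k. a k powr \<theta> * (1 / 2^l) powr s)"
    using F by (intro sum.swap_restrict) auto
  also have "\<dots> = (\<Sum>k\<in>F. a k powr \<theta> * (\<Sum>l | l < L \<and> 1 / 2^l \<le> a k. (1 / 2^l) powr s))"
    by (simp add: sum_distrib_left)
  also have "\<dots> \<le> (\<Sum>k\<in>F. a k powr \<theta> * (a k powr s / (1 - 2 powr (-s))))"
    by (intro sum_mono mult_left_mono sum_levels_le Fpos s) auto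
  also have "\<dots> = (\<Sum>k\<in>F. c * a k powr q)"
    by (simp add: c_def powr_add[symmetric] s_def mult.commute)
  also have "\<dots> = c * (\<Sum>k\<in>F. a k powr q)" by (simp add: sum_distrib_left)
  also have "\<dots> \<le> c * (\<Sum>k. a k powr q)"
    using c F assms(1) by (intro mult_left_mono sum_le_suminf) auto
  finally show "(\<Sum>l<L. (\<Sum>k | 1 / 2^l \<le> a k. a k powr \<theta>) * (1 / 2^l) powr (q - \<theta>)) \<le>
      c * (\<Sum>k. a k powr q)" by (simp add: s_def)
qed (simp add: sum_nonneg)

text \<open>An index between \<open>N l\<close> and \<open>N (l + 1)\<close> has
  \<open>a n powr q\<close> at most \<open>(C / 2^l) powr q\<close>, and there are at most
  \<open>N (l + 1)\<close> such indices. Indices below \<open>N 0\<close> use the crude bound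
  \<open>A\<close>.\<close>

lemma summable_powr_from_levels:
  fixes a :: "nat \<Rightarrow> real" and N :: "nat \<Rightarrow> nat"
  assumes "\<And>n. 0 \<le> a n" "\<And>n. a n \<le> A" "\<And>l n. N l \<le> n \<Longrightarrow> a n \<le> C / 2^l" "0 \<le> C" "0 < q"
    and sN: "summable (\<lambda>l. real (N l) * (1 / 2^l) powr q)"
  shows "summable (\<lambda>n. a n powr q)"
proof (rule summableI_nonneg_bounded)
  fix M
  define e where "e l = (C / 2^l) powr q" for l
  have e0: "0 \<le> e l" for l by (simp add: e_def)
  have A0: "0 \<le> A" using assms(1,2) order_trans by blast
  have pt: "a n powr q \<le> (if n < N 0 then A powr q else 0) + (\<Sum>l<L. if n < N (Suc l) then e l else 0) + e L"
    for n L
  proof -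
    consider "n < N 0" | l where "l < L" "N l \<le> n" "n < N (Suc l)" | "N L \<le> n"
    proof -
      \<comment> \<open>A discrete intermediate value argument, valid for \<open>N\<close> in any
        order.\<close>
      have "n < N 0 \<or> (\<exists>l<L. N l \<le> n \<and> n < N (Suc l)) \<or> N L \<le> n"
        by (induction L) (auto simp: not_le less_Suc_eq)
      then show ?thesis using that by blast
    qed
    then show ?thesis
    proof cases
      case 1
      then show ?thesis using powr_mono2[of q "a n" A] assms(1,2,5)
        by (auto intro!: add_increasing2 sum_nonneg e0)
    next
      case 2
      have "a n powr q \<le> e l" unfolding e_def using assms 2 by (intro powr_mono2) auto
      also have "\<dots> = (if n < N (Suc l) then e l else 0)" using 2 by simp
      also have "\<dots> \<le> (\<Sum>l<L. if n < N (Suc l) then e l else 0)"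
        using 2 by (intro member_le_sum) (auto simp: e0)
      finally show ?thesis using e0[of L] by (simp add: add_increasing add_increasing2)
    next
      case 3
      have "a n powr q \<le> e L" unfolding e_def using assms 3 by (intro powr_mono2) auto
      then show ?thesis by (intro add_increasing add_nonneg_nonneg sum_nonneg) (auto simp: e0)
    qed
  qed
  define D where "D = real (N 0) * A powr q +
    (2 * C) powr q * (\<Sum>l. real (N (Suc l)) * (1 / 2^(Suc l)) powr q)"
  have sN': "summable (\<lambda>l. real (N (Suc l)) * (1 / 2^(Suc l)) powr q)"
    using sN by (subst summable_Suc_iff)
  have ind: "(\<Sum>n<M. if n < m then t else 0) \<le> real m * t" if "0 \<le> t" for m and t :: real
  proof -
    have "(\<Sum>n<M. if n < m then t else 0) = real (card {n. n < M \<and> n < m}) * t"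
      by (subst sum.inter_filter[symmetric]) auto
    also have "card {n. n < M \<and> n < m} \<le> card {..<m}" by (intro card_mono) auto
    finally show ?thesis using that by (simp add: mult_right_mono)
  qed
  have "(\<Sum>n<M. a n powr q) \<le> D + real M * e L" for L
  proof -
    have "(\<Sum>n<M. a n powr q) \<le> (\<Sum>n<M. (if n < N 0 then A powr q else 0) +
        (\<Sum>l<L. if n < N (Suc l) then e l else 0) + e L)"
      by (intro sum_mono pt)
    also have "\<dots> = (\<Sum>n<M. if n < N 0 then A powr q else 0) +
        (\<Sum>l<L. \<Sum>n<M. if n < N (Suc l) then e l else 0) + real M * e L"
      by (simp add: sum.distrib sum.swap[of _ "{..<M}" "{..<L}"])
    also have "\<dots> \<le> real (N 0) * A powr q + (\<Sum>l<L. real (N (Suc l)) * e l) + real M * e L"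
      by (intro add_mono sum_mono ind) (auto simp: e0)
    also have "(\<Sum>l<L. real (N (Suc l)) * e l) =
        (2 * C) powr q * (\<Sum>l<L. real (N (Suc l)) * (1 / 2^(Suc l)) powr q)"
    proof -
      \<comment> \<open>The error at level \<open>l\<close> is paired with the count at level
        \<open>l + 1\<close>; the shift costs the factor 2.\<close>
      have "e l = (2 * C) powr q * (1 / 2^(Suc l)) powr q" for l
        unfolding e_def using assms by (subst powr_mult[symmetric]) auto
      then show ?thesis by (simp add: sum_distrib_left mult_ac)
    qed
    also have "\<dots> \<le> (2 * C) powr q * (\<Sum>l. real (N (Suc l)) * (1 / 2^(Suc l)) powr q)"
      by (intro mult_left_mono sum_le_suminf sN') auto
    finally show ?thesis by (simp add: D_def)
  qed
  \<comment> \<open>With \<open>M\<close> fixed, letting \<open>L\<close> grow removes the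
    contribution of indices beyond the last level.\<close>
  moreover have "(\<lambda>L. D + real M * e L) \<longlonglongrightarrow> D + real M * (C powr q * 0)"
  proof -
    have "e = (\<lambda>L. C powr q * (2 powr (-q)) ^ L)"
      unfolding e_def using assms half_power_powr[of _ q] powr_mult[of C "1 / 2^L" q for L]
      by (auto simp: fun_eq_iff)
    moreover have "(\<lambda>L. (2 powr (-q)) ^ L) \<longlonglongrightarrow> (0::real)"
      using two_powr_minus_less_1[OF assms(5)] by (intro LIMSEQ_realpow_zero) auto
    ultimately show ?thesis by (simp only:) (intro tendsto_add tendsto_const tendsto_mult_left)
  qed
  ultimately show "(\<Sum>n<M. a n powr q) \<le> D"
    using LIMSEQ_le_const[of "\<lambda>L. D + real M * e L" D "\<Sum>n<M. a n powr q"] by auto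
qed simp

text \<open>Mean value theorem with an increasing derivative; \<open>b = 0\<close> is treated apart,
  to keep away from the derivative of \<open>powr\<close> at 0.\<close>

lemma powr_diff_le:
  fixes b c q :: real
  assumes "0 \<le> b" "b \<le> c" "1 \<le> q"
  shows "c powr q \<le> b powr q + q * (c - b) * c powr (q - 1)"
proof -
  consider "c = b" | "b = 0" "0 < c" | "0 < b" "b < c" using assms by linarith
  then show ?thesis
  proof cases
    case 2
    then have "c * c powr (q - 1) = c powr q" by (simp add: powr_mult_base)
    then have "q * (c - b) * c powr (q - 1) = q * c powr q" using 2 by (simp add: mult.assoc)
    then show ?thesis using 2 assms(3) mult_right_mono[OF assms(3) powr_ge_zero[of c q]]
        powr_ge_zero[of b q] by linarith
  next
    case 3
    have "((\<lambda>z. z powr q) has_real_derivative q * x powr (q - 1)) (at x)" if "b \<le> x" for x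
      using that 3 by (intro has_real_derivative_powr) auto
    then obtain z where z: "b < z" "z < c" "c powr q - b powr q = (c - b) * (q * z powr (q - 1))"
      using MVT2[OF 3(2), of "\<lambda>z. z powr q" "\<lambda>z. q * z powr (q - 1)"]
      by blast
    have "(c - b) * (q * z powr (q - 1)) \<le> (c - b) * (q * c powr (q - 1))"
      using z 3 assms by (intro mult_left_mono powr_mono2) auto
    then show ?thesis using z(3) by (simp add: mult_ac)
  qed simp
qed

text \<open>Summation by parts against the tails of the series, which are controlled by the geometric
  pointwise bound; this replaces interpolation between weak-type estimates.\<close>

lemma powr_sum_geometric_le:
  fixes x :: "nat \<Rightarrow> real"
  assumes "\<And>l. 0 \<le> x l" "\<And>l. x l \<le> A / 2^l" "1 \<le> q" "0 \<le> s" "s \<le> 2 * A / 2^L"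
  shows "((\<Sum>l<L. x l) + s) powr q \<le> s powr q + q * (\<Sum>l<L. x l * (2 * A / 2^l) powr (q - 1))"
  using assms(4,5)
proof (induction L arbitrary: s)
  case (Suc L)
  \<comment> \<open>The factor 2 makes the remainder bound reproduce itself: both \<open>x L\<close>
    and \<open>s\<close> are at most \<open>A / 2^L\<close>.\<close>
  have le: "x L + s \<le> 2 * A / 2^L" using Suc.prems(2) assms(2)[of L] by simp
  have "((\<Sum>l<Suc L. x l) + s) powr q = ((\<Sum>l<L. x l) + (x L + s)) powr q" by (simp add: add.assoc)
  also have "\<dots> \<le> (x L + s) powr q + q * (\<Sum>l<L. x l * (2 * A / 2^l) powr (q - 1))"
    using Suc.prems assms(1)[of L] le by (intro Suc.IH) auto
  also have "(x L + s) powr q \<le> s powr q + q * x L * (x L + s) powr (q - 1)"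
    using powr_diff_le[of s "x L + s" q] Suc.prems assms(1)[of L] assms(3) by simp
  also have "\<dots> \<le> s powr q + q * x L * (2 * A / 2^L) powr (q - 1)"
    using Suc.prems assms(1)[of L] assms(3) le
    by (intro add_left_mono mult_left_mono powr_mono2) auto
  finally show ?case by (simp add: algebra_simps)
qed simp

subsection \<open>Approximation numbers\<close>

lemma opnorm_le:
  assumes "\<And>x. x \<in> ell2 \<Longrightarrow> l2norm (T x) \<le> A * l2norm x" "0 \<le> A"
  shows "opnorm T \<le> A"
  unfolding opnorm_def
proof (rule cSup_least)
  show "{l2norm (T x) |x. x \<in> ell2 \<and> l2norm x \<le> 1} \<noteq> {}"
    using ell2_zero l2norm_zero zero_le_one by (metis (mono_tags, lifting) empty_iff mem_Collect_eq)
  fix y assume "y \<in> {l2norm (T x) |x. x \<in> ell2 \<and> l2norm x \<le> 1}"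
  then obtain x where x: "y = l2norm (T x)" "x \<in> ell2" "l2norm x \<le> 1" by blast
  then show "y \<le> A" using assms(1)[of x] mult_left_mono[OF x(3) assms(2)] by simp
qed

lemma bounded_opI:
  assumes "\<And>x. x \<in> ell2 \<Longrightarrow> T x \<in> ell2"
    and "\<And>x y. x \<in> ell2 \<Longrightarrow> y \<in> ell2 \<Longrightarrow> T (\<lambda>i. x i + y i) = (\<lambda>i. T x i + T y i)"
    and "\<And>a x. x \<in> ell2 \<Longrightarrow> T (\<lambda>i. a * x i) = (\<lambda>i. a * T x i)"
    and "\<And>x. x \<in> ell2 \<Longrightarrow> l2norm (T x) \<le> C * l2norm x"
  shows "bounded_op T"
  using assms unfolding bounded_op_def by blast

lemma bounded_opD:
  assumes "bounded_op T"
  shows "x \<in> ell2 \<Longrightarrow> T x \<in> ell2"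
    "x \<in> ell2 \<Longrightarrow> y \<in> ell2 \<Longrightarrow> T (\<lambda>i. x i + y i) = (\<lambda>i. T x i + T y i)"
    "x \<in> ell2 \<Longrightarrow> T (\<lambda>i. a * x i) = (\<lambda>i. a * T x i)"
  using assms unfolding bounded_op_def by blast+

lemma bounded_op_norm:
  assumes "bounded_op T"
  obtains C where "0 \<le> C" "\<And>x. x \<in> ell2 \<Longrightarrow> l2norm (T x) \<le> C * l2norm x"
proof -
  obtain C where C: "\<And>x. x \<in> ell2 \<Longrightarrow> l2norm (T x) \<le> C * l2norm x"
    using assms unfolding bounded_op_def by blast
  show ?thesis
  proof (rule that[of "max C 0"])
    show "l2norm (T x) \<le> max C 0 * l2norm x" if "x \<in> ell2" for x
      using C[OF that] mult_right_mono[OF max.cobounded1[of C 0] l2norm_nonneg[OF that]] by linarith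
  qed simp
qed

lemma le_opnorm:
  assumes "bounded_op T" "x \<in> ell2"
  shows "l2norm (T x) \<le> opnorm T * l2norm x"
proof -
  obtain C where C: "0 \<le> C" "\<And>x. x \<in> ell2 \<Longrightarrow> l2norm (T x) \<le> C * l2norm x"
    using bounded_op_norm[OF assms(1)] by metis
  show ?thesis
  proof (cases "l2norm x = 0")
    case True
    then show ?thesis using C(2)[OF assms(2)] by simp
  next
    case False
    define n where "n = l2norm x"
    have n: "n > 0" using False l2norm_nonneg[OF assms(2)] by (simp add: n_def)
    define u where "u = (\<lambda>i. complex_of_real (1 / n) * x i)"
    have u: "u \<in> ell2" "l2norm u \<le> 1"
      using ell2_scale[OF assms(2)] l2norm_scale[OF assms(2), of "complex_of_real (1 / n)"] n
      unfolding u_def by (simp_all only:) (simp add: norm_divide flip: n_def)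
    have "l2norm (T u) \<le> opnorm T"
      unfolding opnorm_def
    proof (rule cSup_upper)
      show "bdd_above {l2norm (T x) |x. x \<in> ell2 \<and> l2norm x \<le> 1}"
      proof (rule bdd_aboveI)
        fix y assume "y \<in> {l2norm (T x) |x. x \<in> ell2 \<and> l2norm x \<le> 1}"
        then obtain x where x: "y = l2norm (T x)" "x \<in> ell2" "l2norm x \<le> 1" by blast
        then show "y \<le> C" using C(2)[of x] mult_left_mono[OF x(3) C(1)] by simp
      qed
    qed (use u in blast)
    also have "T u = (\<lambda>i. complex_of_real (1 / n) * T x i)"
      unfolding u_def by (rule bounded_opD(3)[OF assms])
    also have "l2norm \<dots> = (1 / n) * l2norm (T x)"
      using n by (subst l2norm_scale) (auto simp: bounded_opD(1)[OF assms] norm_divide)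
    finally show ?thesis using n by (simp add: field_simps n_def)
  qed
qed

lemma opnorm_nonneg: "bounded_op T \<Longrightarrow> 0 \<le> opnorm T"
  using le_opnorm[of T "unitv 0"] l2norm_nonneg[OF bounded_opD(1), of T "unitv 0"] by simp

lemma bounded_op_add:
  assumes "bounded_op P" "bounded_op Q"
  shows "bounded_op (\<lambda>x i. P x i + Q x i)"
proof -
  obtain C where C: "\<And>x. x \<in> ell2 \<Longrightarrow> l2norm (P x) \<le> C * l2norm x" using bounded_op_norm[OF assms(1)] by metis
  obtain D where D: "\<And>x. x \<in> ell2 \<Longrightarrow> l2norm (Q x) \<le> D * l2norm x" using bounded_op_norm[OF assms(2)] by metis
  have "l2norm (\<lambda>i. P x i + Q x i) \<le> (C + D) * l2norm x" if x: "x \<in> ell2" for x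
    using l2norm_add[OF bounded_opD(1)[OF assms(1) x] bounded_opD(1)[OF assms(2) x]] C[OF x] D[OF x]
    by (simp add: algebra_simps)
  then show ?thesis
    by (intro bounded_opI[where C = "C + D"])
      (auto simp: bounded_opD[OF assms(1)] bounded_opD[OF assms(2)] algebra_simps intro: ell2_add)
qed

lemma bounded_op_scale:
  assumes "bounded_op P"
  shows "bounded_op (\<lambda>x i. b * P x i)"
proof -
  obtain C where C: "\<And>x. x \<in> ell2 \<Longrightarrow> l2norm (P x) \<le> C * l2norm x" using bounded_op_norm[OF assms(1)] by metis
  have "l2norm (\<lambda>i. b * P x i) \<le> (cmod b * C) * l2norm x" if x: "x \<in> ell2" for x
    using mult_left_mono[OF C[OF x] norm_ge_zero[of b]] by (simp add: l2norm_scale bounded_opD[OF assms x] mult_ac)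
  then show ?thesis
    by (intro bounded_opI[where C = "cmod b * C"])
      (auto simp: bounded_opD[OF assms(1)] algebra_simps intro: ell2_scale)
qed

lemma bounded_op_diff:
  assumes "bounded_op P" "bounded_op Q"
  shows "bounded_op (\<lambda>x i. P x i - Q x i)"
  using bounded_op_add[OF assms(1) bounded_op_scale[OF assms(2), of "-1"]] by simp

lemma bounded_op_zero [simp]: "bounded_op (\<lambda>x i. 0)"
  unfolding bounded_op_def by (auto intro: exI[of _ 0])

lemma rank_le_zero [simp]: "rank_le (\<lambda>x i. 0) n"
  unfolding rank_le_def by (rule exI[of _ "\<lambda>k i. 0"]) auto

lemma rank_le_add:
  assumes "rank_le P m" "rank_le Q n"
  shows "rank_le (\<lambda>x i. P x i + Q x i) (m + n)"
proof -
  obtain v where v: "\<And>k. k < m \<Longrightarrow> v k \<in> ell2" "\<And>x. x \<in> ell2 \<Longrightarrow> \<exists>a. P x = (\<lambda>i. \<Sum>k<m. a k * v k i)"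
    using assms(1) unfolding rank_le_def by blast
  obtain w where w: "\<And>k. k < n \<Longrightarrow> w k \<in> ell2" "\<And>x. x \<in> ell2 \<Longrightarrow> \<exists>a. Q x = (\<lambda>i. \<Sum>k<n. a k * w k i)"
    using assms(2) unfolding rank_le_def by blast
  have split: "(\<Sum>k<m+n. f k) = (\<Sum>k<m. f k) + (\<Sum>k<n. f (m + k))" for f :: "nat \<Rightarrow> complex"
    by (induction n) (auto simp: algebra_simps)
  show ?thesis
    unfolding rank_le_def
  proof (rule exI[of _ "\<lambda>k. if k < m then v k else w (k - m)"], intro conjI ballI allI impI)
    show "(if k < m then v k else w (k - m)) \<in> ell2" if "k < m + n" for k
      using that v(1) w(1) by auto
    fix x assume "x \<in> ell2"
    then obtain a b where "P x = (\<lambda>i. \<Sum>k<m. a k * v k i)" "Q x = (\<lambda>i. \<Sum>k<n. b k * w k i)"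
      using v(2) w(2) by blast
    then have "(\<lambda>i. P x i + Q x i) = (\<lambda>i. \<Sum>k<m+n. (if k < m then a k else b (k - m)) *
        (if k < m then v k else w (k - m)) i)"
      unfolding split by auto
    then show "\<exists>a. (\<lambda>i. P x i + Q x i) =
        (\<lambda>i. \<Sum>k<m+n. a k * (if k < m then v k else w (k - m)) i)"
      by (rule exI[of _ "\<lambda>k. if k < m then a k else b (k - m)"])
  qed
qed

lemma approx_num_le:
  assumes "bounded_op T" "bounded_op P" "rank_le P n"
    and "\<And>x. x \<in> ell2 \<Longrightarrow> l2norm (\<lambda>i. T x i - P x i) \<le> A * l2norm x" "0 \<le> A"
  shows "approx_num T n \<le> A"
proof -
  have "approx_num T n \<le> opnorm (\<lambda>x i. T x i - P x i)"
    unfolding approx_num_def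
  proof (rule cInf_lower)
    show "bdd_below {opnorm (\<lambda>x i. T x i - P x i) |P. bounded_op P \<and> rank_le P n}"
      by (rule bdd_belowI[of _ 0]) (auto intro!: opnorm_nonneg bounded_op_diff assms)
  qed (use assms in blast)
  also have "\<dots> \<le> A" by (rule opnorm_le[OF assms(4,5)])
  finally show ?thesis .
qed

lemma approx_num_nonempty: "{opnorm (\<lambda>x i. T x i - P x i) |P. bounded_op P \<and> rank_le P n} \<noteq> {}"
  using bounded_op_zero rank_le_zero by blast

lemma approx_num_nonneg: "bounded_op T \<Longrightarrow> 0 \<le> approx_num T n"
  unfolding approx_num_def
  by (rule cInf_greatest[OF approx_num_nonempty]) (auto intro!: opnorm_nonneg bounded_op_diff)

lemma approx_num_lessE:
  assumes "bounded_op T" "approx_num T n < t"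
  obtains P where "bounded_op P" "rank_le P n"
    "\<And>x. x \<in> ell2 \<Longrightarrow> l2norm (\<lambda>i. T x i - P x i) \<le> t * l2norm x"
proof -
  obtain P where P: "bounded_op P" "rank_le P n" "opnorm (\<lambda>x i. T x i - P x i) < t"
    using cInf_lessD[OF approx_num_nonempty assms(2)[unfolded approx_num_def]] by blast
  have "l2norm (\<lambda>i. T x i - P x i) \<le> t * l2norm x" if "x \<in> ell2" for x
    using le_opnorm[OF bounded_op_diff[OF assms(1) P(1)] that]
      mult_right_mono[OF less_imp_le[OF P(3)] l2norm_nonneg[OF that]] by linarith
  then show ?thesis using that P by blast
qed

lemma matrix_bounded_bounded_op:
  assumes "matrix_bounded M"
  shows "bounded_op (mat_apply M)"
proof -
  obtain C where "\<forall>x\<in>ell2. (\<forall>i. summable (\<lambda>j. M i j * x j)) \<and>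
      mat_apply M x \<in> ell2 \<and> l2norm (mat_apply M x) \<le> C * l2norm x"
    using assms unfolding matrix_bounded_def by (elim exE)
  then have C: "\<And>x i. x \<in> ell2 \<Longrightarrow> summable (\<lambda>j. M i j * x j)"
    "\<And>x. x \<in> ell2 \<Longrightarrow> mat_apply M x \<in> ell2"
    "\<And>x. x \<in> ell2 \<Longrightarrow> l2norm (mat_apply M x) \<le> C * l2norm x"
    by simp_all
  have "mat_apply M (\<lambda>i. x i + y i) = (\<lambda>i. mat_apply M x i + mat_apply M y i)"
    if "x \<in> ell2" "y \<in> ell2" for x y
    unfolding mat_apply_def by (simp add: suminf_add C(1) that distrib_left)
  moreover have "mat_apply M (\<lambda>i. a * x i) = (\<lambda>i. a * mat_apply M x i)" if "x \<in> ell2" for a x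
    unfolding mat_apply_def by (simp add: suminf_mult[symmetric] C(1) that mult.left_commute)
  ultimately show ?thesis using C(2,3) by (intro bounded_opI)
qed

subsection \<open>Diagonals of Schatten class operators\<close>

definition lift_op :: "((nat \<Rightarrow> complex) \<Rightarrow> nat \<Rightarrow> complex) \<Rightarrow> l2 \<Rightarrow> l2" where
  "lift_op T x = Abs_l2 (T (Rep_l2 x))"

lemma Rep_lift_op: "bounded_op T \<Longrightarrow> Rep_l2 (lift_op T x) = T (Rep_l2 x)"
  unfolding lift_op_def by (rule Abs_l2_inverse) (rule bounded_opD(1)[OF _ Rep_l2])

lemma linear_lift_op:
  assumes "bounded_op T"
  shows "linear (lift_op T)"
proof (rule linearI)
  fix x y :: l2 and r :: real
  show "lift_op T (x + y) = lift_op T x + lift_op T y"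
    unfolding Rep_l2_inject[symmetric]
    by (simp add: Rep_lift_op[OF assms] plus_l2.rep_eq bounded_opD(2)[OF assms Rep_l2 Rep_l2])
  show "lift_op T (r *\<^sub>R x) = r *\<^sub>R lift_op T x"
    unfolding Rep_l2_inject[symmetric]
    by (simp add: Rep_lift_op[OF assms] scaleR_l2.rep_eq scaleR_conv_of_real bounded_opD(3)[OF assms Rep_l2])
qed

lemma Rep_l2_sum: "Rep_l2 (sum f F) i = (\<Sum>k\<in>F. Rep_l2 (f k) i)"
  by (induction F rule: infinite_finite_induct) (auto simp: zero_l2.rep_eq plus_l2.rep_eq)

text \<open>Over the reals a complex coefficient splits into two, so each \<open>v k\<close> is
  accompanied by its multiple by the imaginary unit.\<close>

lemma rank_le_span:
  assumes "bounded_op T" "rank_le T n"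
  obtains B where "finite B" "card B \<le> 2 * n" "\<And>x. lift_op T x \<in> span B"
proof -
  obtain v where v: "\<And>k. k < n \<Longrightarrow> v k \<in> ell2" "\<And>x. x \<in> ell2 \<Longrightarrow> \<exists>a. T x = (\<lambda>i. \<Sum>k<n. a k * v k i)"
    using assms(2) unfolding rank_le_def by blast
  define V where "V k = Abs_l2 (v k)" for k
  define W where "W k = Abs_l2 (\<lambda>i. \<i> * v k i)" for k
  define B where "B = V ` {..<n} \<union> W ` {..<n}"
  have "card B \<le> card (V ` {..<n}) + card (W ` {..<n})" unfolding B_def by (rule card_Un_le)
  also have "\<dots> \<le> n + n" using card_image_le[of "{..<n}"] by (intro add_mono) force+
  finally have card: "card B \<le> 2 * n" by simp
  have "lift_op T x \<in> span B" for x
  proof -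
    obtain a where a: "T (Rep_l2 x) = (\<lambda>i. \<Sum>k<n. a k * v k i)" using v(2)[OF Rep_l2] by blast
    have "lift_op T x = (\<Sum>k<n. Re (a k) *\<^sub>R V k + Im (a k) *\<^sub>R W k)"
      unfolding Rep_l2_inject[symmetric] Rep_lift_op[OF assms(1)] a
    proof (rule ext)
      fix i
      show "(\<Sum>k<n. a k * v k i) = Rep_l2 (\<Sum>k<n. Re (a k) *\<^sub>R V k + Im (a k) *\<^sub>R W k) i"
        unfolding Rep_l2_sum
      proof (intro sum.cong refl)
        fix k assume "k \<in> {..<n}"
        then have vk: "v k \<in> ell2" "(\<lambda>i. \<i> * v k i) \<in> ell2" using v(1) ell2_scale by auto
        have "Rep_l2 (Re (a k) *\<^sub>R V k + Im (a k) *\<^sub>R W k) i =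
            (of_real (Re (a k)) + \<i> * of_real (Im (a k))) * v k i"
          unfolding plus_l2.rep_eq scaleR_l2.rep_eq V_def W_def Abs_l2_inverse[OF vk(1)]
            Abs_l2_inverse[OF vk(2)] scaleR_conv_of_real
          by (subst distrib_right) (simp only: mult_ac)
        also have "of_real (Re (a k)) + \<i> * of_real (Im (a k)) = a k" by (rule complex_eq[symmetric])
        finally show "a k * v k i = Rep_l2 (Re (a k) *\<^sub>R V k + Im (a k) *\<^sub>R W k) i" by (rule sym)
      qed
    qed
    also have "\<dots> \<in> span B"
      by (intro span_sum span_add span_scale span_base) (auto simp: B_def)
    finally show ?thesis .
  qed
  then show ?thesis using that[of B] card by (simp add: B_def)
qed

lemma norm_lift_op_diff:
  assumes "bounded_op T" "bounded_op P"
  shows "norm (lift_op T x - lift_op P x) = l2norm (\<lambda>i. T (Rep_l2 x) i - P (Rep_l2 x) i)"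
  by (simp add: norm_l2_eq minus_l2.rep_eq Rep_lift_op assms)

text \<open>The ranks at error \<open>1 / 2^l\<close> are at most the number of approximation
  numbers that are at least \<open>1 / 2^l\<close>, and these counts are summable against the
  weights by \<open>summable_levels\<close> with \<theta> = 0.\<close>

lemma low_rank_approximants:
  assumes "bounded_op T" "0 < q" "summable (\<lambda>n. approx_num T n powr q)"
  obtains P r where "\<And>l::nat. bounded_op (P l)" "\<And>l. rank_le (P l) (r l)"
    "\<And>l x. norm (lift_op T x - lift_op (P l) x) \<le> 1 / 2^l * norm x"
    "summable (\<lambda>l. real (r l) * (1 / 2^l) powr q)"
proof -
  define S where "S l = {n. 1 / 2^l \<le> approx_num T n}" for l
  have fin: "finite (S l)" for l unfolding S_def by (rule finite_level[OF assms(3,2)]) simp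
  have "\<exists>n P. n \<le> card (S l) \<and> bounded_op P \<and> rank_le P n \<and>
      (\<forall>x. norm (lift_op T x - lift_op P x) \<le> 1 / 2^l * norm x)" for l
  proof -
    \<comment> \<open>Pigeonhole: \<open>card (S l) + 1\<close> candidate ranks cannot all lie in
      \<open>S l\<close>. This replaces monotonicity of the approximation numbers.\<close>
    have "\<not> {..card (S l)} \<subseteq> S l" using card_mono[OF fin, of "{..card (S l)}" l] by auto
    then obtain n where n: "n \<le> card (S l)" "n \<notin> S l" by auto
    from n(2) have less: "approx_num T n < 1 / 2^l" by (simp add: S_def not_le)
    obtain P where P: "bounded_op P" "rank_le P n"
      "\<And>x. x \<in> ell2 \<Longrightarrow> l2norm (\<lambda>i. T x i - P x i) \<le> 1 / 2^l * l2norm x"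
      using approx_num_lessE[OF assms(1) less] by blast
    have "norm (lift_op T x - lift_op P x) \<le> 1 / 2^l * norm x" for x
      unfolding norm_lift_op_diff[OF assms(1) P(1)] norm_l2_eq[of x] by (rule P(3)[OF Rep_l2])
    then show ?thesis using n(1) P(1,2) by blast
  qed
  then have "\<forall>l. \<exists>n P. n \<le> card (S l) \<and> bounded_op P \<and> rank_le P n \<and>
      (\<forall>x. norm (lift_op T x - lift_op P x) \<le> 1 / 2^l * norm x)" ..
  from choice[OF this] obtain r where
    "\<forall>l. \<exists>P. r l \<le> card (S l) \<and> bounded_op P \<and> rank_le P (r l) \<and>
      (\<forall>x. norm (lift_op T x - lift_op P x) \<le> 1 / 2^l * norm x)" ..
  from choice[OF this] obtain P where
    "\<forall>l. r l \<le> card (S l) \<and> bounded_op (P l) \<and> rank_le (P l) (r l) \<and>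
      (\<forall>x. norm (lift_op T x - lift_op (P l) x) \<le> 1 / 2^l * norm x)" ..
  then have rP: "\<And>l. r l \<le> card (S l)" "\<And>l. bounded_op (P l)" "\<And>l. rank_le (P l) (r l)"
    "\<And>l x. norm (lift_op T x - lift_op (P l) x) \<le> 1 / 2^l * norm x" by simp_all
  have "(\<Sum>k | 1 / 2^l \<le> approx_num T k. approx_num T k powr 0) = real (card (S l))" for l
  proof -
    have "approx_num T k powr 0 = 1" if "k \<in> S l" for k
    proof -
      have "0 < 1 / (2::real)^l" by simp
      also have "1 / 2^l \<le> approx_num T k" using that by (simp add: S_def)
      finally show ?thesis by simp
    qed
    then show ?thesis unfolding S_def[symmetric] by simp
  qed
  then have "summable (\<lambda>l. real (card (S l)) * (1 / 2^l) powr q)"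
    using summable_levels[OF assms(3) approx_num_nonneg[OF assms(1)], of 0] assms(2) by simp
  then have "summable (\<lambda>l. real (r l) * (1 / 2^l) powr q)"
    by (rule summable_comparison_test'[of _ 0]) (auto intro!: mult_right_mono rP simp: abs_mult)
  then show ?thesis using that[of P r] rP(2-4) by blast
qed

text \<open>Telescoping the approximants gives pieces \<open>K l\<close> of norm
  \<open>O(1 / 2^l)\<close> and controlled rank. The rank bounds the diagonal sum of each piece, the
  norm bounds each diagonal entry, and \<open>powr_sum_geometric_le\<close> combines the two into a
  bound for the q-th powers.\<close>

lemma schatten_diagonal_summable:
  assumes "bounded_op T" "1 \<le> q" "summable (\<lambda>n. approx_num T n powr q)"
    and f: "\<And>i j. i \<noteq> j \<Longrightarrow> f i \<bullet> f j = 0" "\<And>k. norm (f k) \<le> 1"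
    and g: "\<And>i j. i \<noteq> j \<Longrightarrow> g i \<bullet> g j = 0" "\<And>k::nat. norm (g k) \<le> 1"
  shows "summable (\<lambda>k. \<bar>lift_op T (f k) \<bullet> g k\<bar> powr q)"
proof -
  obtain C where C: "0 \<le> C" "\<And>x. x \<in> ell2 \<Longrightarrow> l2norm (T x) \<le> C * l2norm x"
    using bounded_op_norm[OF assms(1)] by metis
  have C': "norm (lift_op T x) \<le> C * norm x" for x
    using C(2)[OF Rep_l2] by (simp add: norm_l2_eq Rep_lift_op[OF assms(1)])
  obtain P r where P: "\<And>l::nat. bounded_op (P l)" "\<And>l. rank_le (P l) (r l)"
    "\<And>l x. norm (lift_op T x - lift_op (P l) x) \<le> 1 / 2^l * norm x"
    and sr: "summable (\<lambda>l. real (r l) * (1 / 2^l) powr q)"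
    using low_rank_approximants[OF assms(1) _ assms(3)] assms(2) by auto
  \<comment> \<open>Large enough for three estimates: \<open>C + 1\<close> for the first piece, 3
    for the later differences, and 1 for the remainder in
    \<open>powr_sum_geometric_le\<close>.\<close>
  define A where "A = C + 4"
  define K where "K l x = lift_op (P l) x - (if l = 0 then 0 else lift_op (P (l - 1)) x)" for l x
  define \<rho> where "\<rho> l = 2 * real (r l) + (if l = 0 then 0 else 2 * real (r (l - 1)))" for l
  have lin: "linear (K l)" for l
  proof (cases l)
    case 0
    then show ?thesis using linear_lift_op[OF P(1)] by (simp add: K_def[abs_def])
  next
    case (Suc m)
    then show ?thesis using linear_compose_sub[OF linear_lift_op[OF P(1)] linear_lift_op[OF P(1)]]
      by (simp add: K_def[abs_def])
  qed
  have Kn: "norm (K l x) \<le> A / 2^l * norm x" for l x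
  proof (cases l)
    case 0
    have "norm (lift_op (P 0) x) \<le> norm (lift_op T x) + norm (lift_op T x - lift_op (P 0) x)"
      by norm
    also have "\<dots> \<le> C * norm x + 1 * norm x" using C'[of x] P(3)[of x 0] by (intro add_mono) auto
    also have "\<dots> \<le> A * norm x" by (simp add: A_def algebra_simps)
    finally show ?thesis using 0 by (simp add: K_def)
  next
    case (Suc m)
    have "norm (lift_op (P (Suc m)) x - lift_op (P m) x) \<le>
      norm (lift_op T x - lift_op (P (Suc m)) x) + norm (lift_op T x - lift_op (P m) x)" by norm
    also have "\<dots> \<le> 1 / 2^(Suc m) * norm x + 1 / 2^m * norm x" by (intro add_mono P)
    also have "\<dots> = 3 / 2^(Suc m) * norm x" by (simp add: field_simps)
    also have "\<dots> \<le> A / 2^(Suc m) * norm x"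
      using C by (intro mult_right_mono divide_right_mono) (auto simp: A_def)
    finally show ?thesis using Suc by (simp add: K_def)
  qed
  have Ksum: "(\<Sum>l<Suc L. K l x) = lift_op (P L) x" for L x
    by (induction L) (auto simp: K_def)
  have diag: "(\<Sum>k<n. \<bar>K l (f k) \<bullet> g k\<bar>) \<le> \<rho> l * (A / 2^l)" for l n
  proof -
    obtain B where B: "finite B" "card B \<le> 2 * r l" "\<And>x. lift_op (P l) x \<in> span B"
      using rank_le_span[OF P(1,2)] by blast
    obtain B' where B': "finite B'" "card B' \<le> 2 * r (l - 1)" "\<And>x. lift_op (P (l - 1)) x \<in> span B'"
      using rank_le_span[OF P(1,2)] by blast
    define D where "D = B \<union> (if l = 0 then {} else B')"
    have D: "finite D" using B B' by (simp add: D_def)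
    have "card D \<le> 2 * r l + (if l = 0 then 0 else 2 * r (l - 1))"
      using card_Un_le[of B B'] B(2) B'(2) by (auto simp: D_def)
    then have "real (card D) \<le> real (2 * r l + (if l = 0 then 0 else 2 * r (l - 1)))"
      by (simp only: of_nat_le_iff)
    then have card: "real (card D) \<le> \<rho> l" by (simp add: \<rho>_def split: if_splits)
    have "K l x \<in> span D" for x
      unfolding K_def
      by (intro span_diff) (use B(3) B'(3) in \<open>auto simp: D_def intro: span_zero subsetD[OF span_mono[of _ "B \<union> B'"]]\<close>)
    then have "(\<Sum>k<n. \<bar>K l (f k) \<bullet> g k\<bar>) \<le> real (card D) * (A / 2^l)"
      using f g C by (intro finite_rank_diagonal_sum_le[OF lin Kn _ D]) (auto simp: pairwise_def A_def)
    also have "\<dots> \<le> \<rho> l * (A / 2^l)" using card C by (intro mult_right_mono) (auto simp: A_def)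
    finally show ?thesis .
  qed
  \<comment> \<open>What level \<open>l\<close> contributes over all \<open>k\<close>: its diagonal
    sum times the factor from the summation by parts. Up to a constant this is
    \<open>\<rho> l * (1 / 2^l) powr q\<close>, hence summable.\<close>
  define E where "E l = q * (\<rho> l * (A / 2^l) * (2 * A / 2^l) powr (q - 1))" for l
  have A: "0 < A" using C by (simp add: A_def)
  have \<rho>0: "0 \<le> \<rho> l" for l by (simp add: \<rho>_def)
  have E0: "0 \<le> E l" for l using A assms(2) \<rho>0 by (simp add: E_def)
  have sE: "summable E"
  proof -
    have "E = (\<lambda>l. q * A * (2 * A) powr (q - 1) * (\<rho> l * (1 / 2^l) powr q))"
    proof
      fix l
      have "(2 * A / 2^l) powr (q - 1) = (2 * A) powr (q - 1) * (1 / 2^l) powr (q - 1)"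
        using A powr_mult[of "2 * A" "1 / 2^l" "q - 1"] by simp
      moreover have "(1 / 2^l) powr q = (1 / 2^l) * (1 / 2^l) powr (q - 1)"
        by (subst powr_mult_base) auto
      ultimately show "E l = q * A * (2 * A) powr (q - 1) * (\<rho> l * (1 / 2^l) powr q)"
        by (simp add: E_def)
    qed
    moreover have "summable (\<lambda>l. \<rho> l * (1 / 2^l) powr q)"
    proof -
      have "summable (\<lambda>l. 2 * (real (r (Suc l)) * (1 / 2^(Suc l)) powr q) +
          2 * (1/2) powr q * (real (r l) * (1 / 2^l) powr q))"
        using sr summable_Suc_iff[of "\<lambda>l. real (r l) * (1 / 2^l) powr q"]
        by (intro summable_add summable_mult) auto
      moreover have "(1 / 2^(Suc l)) powr q = (1/2) powr q * (1 / 2^l) powr q" for l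
        using powr_mult[of "1/2" "1 / 2^l" q] by simp
      ultimately have "summable (\<lambda>l. \<rho> (Suc l) * (1 / 2^(Suc l)) powr q)"
        by (simp add: \<rho>_def algebra_simps)
      then show ?thesis by (subst (asm) summable_Suc_iff)
    qed
    ultimately show ?thesis by (simp add: summable_mult)
  qed
  have fin: "(\<Sum>k<n. \<bar>lift_op T (f k) \<bullet> g k\<bar> powr q) \<le> real n * (1 / 2^L) powr q + suminf E" for n L
  proof -
    have "\<bar>lift_op T (f k) \<bullet> g k\<bar> powr q \<le> (1 / 2^L) powr q +
        q * (\<Sum>l<Suc L. \<bar>K l (f k) \<bullet> g k\<bar> * (2 * A / 2^l) powr (q - 1))" for k
    proof -
      have cs: "\<bar>y \<bullet> g k\<bar> \<le> norm y" for y
        using Cauchy_Schwarz_ineq2[of y "g k"] mult_left_mono[OF g(2)[of k] norm_ge_zero[of y]] by simp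
      \<comment> \<open>The pieces up to level \<open>L\<close> add up to \<open>P L\<close>; what
        remains is at most \<open>1 / 2^L\<close>.\<close>
      have "lift_op T (f k) \<bullet> g k = (\<Sum>l<Suc L. K l (f k) \<bullet> g k) + (lift_op T (f k) - lift_op (P L) (f k)) \<bullet> g k"
        unfolding inner_sum_left[symmetric] Ksum by (simp add: inner_diff_left)
      also have "\<bar>\<dots>\<bar> \<le> \<bar>\<Sum>l<Suc L. K l (f k) \<bullet> g k\<bar> + \<bar>(lift_op T (f k) - lift_op (P L) (f k)) \<bullet> g k\<bar>"
        by (rule abs_triangle_ineq)
      also have "\<dots> \<le> (\<Sum>l<Suc L. \<bar>K l (f k) \<bullet> g k\<bar>) + 1 / 2^L"
      proof (intro add_mono sum_abs)
        have "norm (lift_op T (f k) - lift_op (P L) (f k)) \<le> 1 / 2^L * 1"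
          using P(3)[of "f k" L] mult_left_mono[OF f(2)[of k], of "1 / 2^L"] by simp
        then show "\<bar>(lift_op T (f k) - lift_op (P L) (f k)) \<bullet> g k\<bar> \<le> 1 / 2^L"
          using cs[of "lift_op T (f k) - lift_op (P L) (f k)"] by simp
      qed
      finally have "\<bar>lift_op T (f k) \<bullet> g k\<bar> powr q \<le> ((\<Sum>l<Suc L. \<bar>K l (f k) \<bullet> g k\<bar>) + 1 / 2^L) powr q"
        using assms(2) by (intro powr_mono2) auto
      also have "\<dots> \<le> (1 / 2^L) powr q +
          q * (\<Sum>l<Suc L. \<bar>K l (f k) \<bullet> g k\<bar> * (2 * A / 2^l) powr (q - 1))"
      proof (rule powr_sum_geometric_le)
        show "\<bar>K l (f k) \<bullet> g k\<bar> \<le> A / 2^l" for l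
          using cs[of "K l (f k)"] Kn[of l "f k"] mult_left_mono[OF f(2)[of k], of "A / 2^l"] A by simp
        show "1 / 2^L \<le> 2 * A / 2^Suc L" using C by (simp add: A_def field_simps)
      qed (use assms in auto)
      finally show ?thesis .
    qed
    then have "(\<Sum>k<n. \<bar>lift_op T (f k) \<bullet> g k\<bar> powr q) \<le> (\<Sum>k<n. (1 / 2^L) powr q +
        q * (\<Sum>l<Suc L. \<bar>K l (f k) \<bullet> g k\<bar> * (2 * A / 2^l) powr (q - 1)))"
      by (rule sum_mono)
    also have "\<dots> = real n * (1 / 2^L) powr q +
        q * (\<Sum>l<Suc L. (\<Sum>k<n. \<bar>K l (f k) \<bullet> g k\<bar>) * (2 * A / 2^l) powr (q - 1))"
      by (simp only: sum.distrib sum_distrib_left[symmetric] sum_distrib_right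
          sum.swap[of _ "{..<n}" "{..<Suc L}"]) simp
    also have "q * (\<Sum>l<Suc L. (\<Sum>k<n. \<bar>K l (f k) \<bullet> g k\<bar>) * (2 * A / 2^l) powr (q - 1)) \<le>
        q * (\<Sum>l<Suc L. (\<rho> l * (A / 2^l)) * (2 * A / 2^l) powr (q - 1))"
      using assms(2) by (intro mult_left_mono sum_mono mult_right_mono diag) auto
    also have "\<dots> = (\<Sum>l<Suc L. E l)" by (simp only: E_def sum_distrib_left)
    also have "\<dots> \<le> suminf E" by (rule sum_le_suminf[OF sE]) (auto simp: E0)
    finally show ?thesis by simp
  qed
  show ?thesis
  proof (rule summableI_nonneg_bounded)
    fix n
    \<comment> \<open>For fixed \<open>n\<close> the remainders of all \<open>n\<close> entries
      disappear as \<open>L\<close> grows.\<close>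
    have "(\<lambda>L. real n * (2 powr (-q)) ^ L + suminf E) \<longlonglongrightarrow> real n * 0 + suminf E"
      using two_powr_minus_less_1[of q] assms(2)
      by (intro tendsto_intros LIMSEQ_realpow_zero) auto
    then show "(\<Sum>k<n. \<bar>lift_op T (f k) \<bullet> g k\<bar> powr q) \<le> suminf E"
      using LIMSEQ_le_const[of "\<lambda>L. real n * (2 powr (-q)) ^ L + suminf E" "real n * 0 + suminf E"]
        fin[of n, unfolded half_power_powr] by auto
  qed simp
qed

section \<open>Necessity for the Schatten classes: explicit orthogonal systems\<close>

lemma inner_Abs_l2: "x \<in> ell2 \<Longrightarrow> y \<in> ell2 \<Longrightarrow> Abs_l2 x \<bullet> Abs_l2 y = (\<Sum>i. x i \<bullet> y i)"
  by (simp add: inner_l2.rep_eq Abs_l2_inverse)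

lemma inner_Abs_l2_finite:
  assumes "x \<in> ell2" "finite F" "\<And>i. i \<notin> F \<Longrightarrow> y i = 0"
  shows "Abs_l2 x \<bullet> Abs_l2 y = (\<Sum>i\<in>F. x i \<bullet> y i)"
  using suminf_finite[OF assms(2), of "\<lambda>i. x i \<bullet> y i"] assms
  by (simp add: inner_Abs_l2 ell2_finite_support[OF assms(2,3)])

lemma inner_Abs_l2_disjoint:
  assumes "x \<in> ell2" "y \<in> ell2" "\<And>i. x i = 0 \<or> y i = 0"
  shows "Abs_l2 x \<bullet> Abs_l2 y = 0"
proof -
  have "x i \<bullet> y i = 0" for i using assms(3)[of i] by auto
  then show ?thesis by (simp add: inner_Abs_l2 assms)
qed

lemma lift_op_Abs: "x \<in> ell2 \<Longrightarrow> lift_op T (Abs_l2 x) = Abs_l2 (T x)"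
  by (simp add: lift_op_def Abs_l2_inverse)

lemma dyadic_block_disjoint:
  assumes "j \<in> {2^m<..2^(m+1)::nat}" "j \<in> {2^n<..2^(n+1)}"
  shows "m = n"
proof (rule ccontr)
  assume "m \<noteq> n"
  moreover have "(2::nat)^(m+1) \<le> 2^n" if "m < n" for m n
    using that by (intro power_increasing) auto
  ultimately have "(2::nat)^(m+1) \<le> 2^n \<or> (2::nat)^(n+1) \<le> 2^m" using linorder_neqE_nat by blast
  then show False using assms by auto
qed

text \<open>The conjugate phase in \<open>u k\<close> turns the real inner product into
  \<open>cmod (c k)\<close> instead of \<open>Re (c k)\<close>. For \<open>c k = 0\<close> the
  vector \<open>u k\<close> is zero.\<close>

lemma schatten_Tmat_imp_diagonal:
  assumes "matrix_schatten q (Tmat c)" "1 < q"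
  shows "summable (\<lambda>k. cmod (c k) powr q)"
proof -
  have T: "bounded_op (mat_apply (Tmat c))" "summable (\<lambda>n. approx_num (mat_apply (Tmat c)) n powr q)"
    using assms by (auto simp: matrix_schatten_def matrix_bounded_bounded_op)
  define u where "u k = (\<lambda>i. cnj (sgn (c k)) * unitv k i)" for k
  have u: "u k \<in> ell2" for k unfolding u_def by (intro ell2_scale unitv_ell2)
  have "summable (\<lambda>k. \<bar>lift_op (mat_apply (Tmat c)) (Abs_l2 (u k)) \<bullet> Abs_l2 (unitv k)\<bar> powr q)"
  proof (rule schatten_diagonal_summable[OF T(1) _ T(2)])
    show "norm (Abs_l2 (u k)) \<le> 1" for k
    proof -
      have "l2norm (u k) = cmod (cnj (sgn (c k))) * l2norm (unitv k)"
        unfolding u_def by (rule l2norm_scale) simp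
      then show ?thesis unfolding l2norm_eq[OF u, symmetric] by (simp add: norm_sgn)
    qed
    show "norm (Abs_l2 (unitv k)) \<le> 1" for k by (simp add: l2norm_eq[symmetric])
    show "Abs_l2 (u i) \<bullet> Abs_l2 (u j) = 0" if "i \<noteq> j" for i j
      using that by (intro inner_Abs_l2_disjoint u) (auto simp: unitv_def u_def)
    show "Abs_l2 (unitv i) \<bullet> Abs_l2 (unitv j) = 0" if "i \<noteq> j" for i j
      using that by (intro inner_Abs_l2_disjoint unitv_ell2) (auto simp: unitv_def)
  qed (use assms in auto)
  moreover have "lift_op (mat_apply (Tmat c)) (Abs_l2 (u k)) \<bullet> Abs_l2 (unitv k) = cmod (c k)" for k
  proof -
    have "lift_op (mat_apply (Tmat c)) (Abs_l2 (u k)) \<bullet> Abs_l2 (unitv k) =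
      (\<Sum>i\<in>{k}. mat_apply (Tmat c) (u k) i \<bullet> unitv k i)"
      unfolding lift_op_Abs[OF u]
      by (rule inner_Abs_l2_finite) (auto simp: bounded_opD(1)[OF T(1) u] unitv_def)
    also have "\<dots> = Re (cnj (sgn (c k)) * c k)"
      unfolding u_def bounded_opD(3)[OF T(1) unitv_ell2] 
      by (simp add: mat_apply_unitv unitv_def inner_complex_def)
    also have "\<dots> = cmod (c k)"
    proof (cases "c k = 0")
      case False
      have "cnj (c k) * c k = of_real ((cmod (c k))^2)" by (metis complex_norm_square mult.commute)
      then have "cnj (sgn (c k)) * c k = of_real ((cmod (c k))^2 / cmod (c k))"
        by (simp add: sgn_eq)
      also have "(cmod (c k))^2 / cmod (c k) = cmod (c k)" using False by (simp add: power2_eq_square)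
      finally show ?thesis by simp
    qed simp
    finally show ?thesis .
  qed
  ultimately show ?thesis by simp
qed

text \<open>Columns of block \<open>n + 1\<close> are paired with rows of block \<open>n\<close>.
  These rows lie above the columns, so the image is constant on them, and the row supports for
  different \<open>n\<close> are disjoint, as orthogonality of the \<open>v n\<close>
  requires.\<close>

lemma schatten_Tmat_imp_blocks:
  assumes "matrix_schatten q (Tmat c)" "1 < q"
  shows "summable (\<lambda>n. dyadic_block c n powr (q / 2))"
proof -
  have T: "bounded_op (mat_apply (Tmat c))" "summable (\<lambda>n. approx_num (mat_apply (Tmat c)) n powr q)"
    using assms by (auto simp: matrix_schatten_def matrix_bounded_bounded_op)
  define d where "d = incr c"
  define u where "u n = blkv d (Suc n)" for n
  define v where "v n i = (if i \<in> {2^n<..2^(n+1)::nat} then complex_of_real (1 / sqrt (2^n)) else 0)" for n i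
  have u: "u n \<in> ell2" for n by (simp add: u_def)
  have v: "v n \<in> ell2" for n by (rule ell2_finite_support[of "{2^n<..2^(n+1)}"]) (auto simp: v_def)
  have card: "card {2^n<..2^(n+1)::nat} = 2^n" for n by simp
  have "summable (\<lambda>n. \<bar>lift_op (mat_apply (Tmat c)) (Abs_l2 (u n)) \<bullet> Abs_l2 (v n)\<bar> powr q)"
  proof (rule schatten_diagonal_summable[OF T(1) _ T(2)])
    show "norm (Abs_l2 (u n)) \<le> 1" for n
      unfolding l2norm_eq[OF u, symmetric] by (simp add: u_def l2norm_blkv_le)
    show "norm (Abs_l2 (v n)) \<le> 1" for n
    proof -
      have "(l2norm (v n))^2 = (\<Sum>i\<in>{2^n<..2^(n+1)}. (cmod (v n i))^2)"
        by (rule l2norm_finite_support) (auto simp: v_def)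
      also have "\<dots> = (\<Sum>i\<in>{2^n<..2^(n+1)::nat}. 1 / 2^n)"
        by (intro sum.cong refl) (auto simp: v_def norm_divide power_divide)
      also have "\<dots> = 1" by simp
      finally show ?thesis unfolding l2norm_eq[OF v, symmetric]
        using l2norm_nonneg[OF v, of n] by (simp add: power2_eq_1_iff)
    qed
    show "Abs_l2 (u i) \<bullet> Abs_l2 (u j) = 0" if "i \<noteq> j" for i j
    proof (rule inner_Abs_l2_disjoint[OF u u])
      show "u i k = 0 \<or> u j k = 0" for k
        using dyadic_block_disjoint[of k "Suc i" "Suc j"] that blkv_support[of k _ d]
        unfolding u_def by blast
    qed
    show "Abs_l2 (v i) \<bullet> Abs_l2 (v j) = 0" if "i \<noteq> j" for i j
    proof (rule inner_Abs_l2_disjoint[OF v v])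
      show "v i k = 0 \<or> v j k = 0" for k
        using dyadic_block_disjoint[of k i j] that unfolding v_def by argo
    qed
  qed (use assms in auto)
  \<comment> \<open>The factor 1/2 arises because block \<open>n\<close> supplies \<open>2^n\<close>
    rows, whereas the quantity for block \<open>n + 1\<close> carries
    \<open>2^(n+1)\<close>.\<close>
  moreover have "\<bar>lift_op (mat_apply (Tmat c)) (Abs_l2 (u n)) \<bullet> Abs_l2 (v n)\<bar> powr q =
      (1/2) powr (q/2) * dyadic_block c (Suc n) powr (q/2)" for n
  proof -
    define S where "S = blksq d (Suc n)"
    have "lift_op (mat_apply (Tmat c)) (Abs_l2 (u n)) \<bullet> Abs_l2 (v n) =
        (\<Sum>i\<in>{2^n<..2^(n+1)}. mat_apply (Tmat c) (u n) i \<bullet> v n i)"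
      unfolding lift_op_Abs[OF u]
      by (rule inner_Abs_l2_finite) (auto simp: bounded_opD(1)[OF T(1) u] v_def)
    also have "\<dots> = (\<Sum>i\<in>{2^n<..2^(n+1)::nat}. sqrt S / sqrt (2^n))"
    proof (intro sum.cong refl)
      fix i assume i: "i \<in> {2^n<..2^(n+1)::nat}"
      then have "mat_apply (Tmat c) (u n) i = complex_of_real (sqrt S)"
        unfolding u_def d_def S_def by (intro mat_apply_blkv) simp
      moreover have "v n i = complex_of_real (1 / sqrt (2^n))" using i by (simp add: v_def)
      ultimately show "mat_apply (Tmat c) (u n) i \<bullet> v n i = sqrt S / sqrt (2^n)"
        by (simp add: inner_complex_def)
    qed
    also have "\<dots> = 2^n * sqrt S / sqrt (2^n)" by simp
    also have "\<dots> = sqrt (2^n * S)"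
      using real_div_sqrt[of "2^n"] by (simp add: real_sqrt_mult field_simps)
    also have "2^n * S = 1/2 * dyadic_block c (Suc n)"
      by (simp add: dyadic_block_eq blk_eq S_def d_def)
    finally have "lift_op (mat_apply (Tmat c)) (Abs_l2 (u n)) \<bullet> Abs_l2 (v n) =
        sqrt (1/2 * dyadic_block c (Suc n))" .
    moreover have "0 \<le> dyadic_block c (Suc n)" by (simp add: dyadic_block_eq)
    ultimately show ?thesis
      by (simp add: powr_half_sqrt[symmetric] powr_powr flip: powr_mult)
  qed
  ultimately have "summable (\<lambda>n. (1/2) powr (q/2) * dyadic_block c (Suc n) powr (q/2))" by simp
  then have "summable (\<lambda>n. dyadic_block c (Suc n) powr (q/2))"
    by (subst (asm) summable_cmult_iff) auto
  \<comment> \<open>Block 0 was not tested, but a single term does not affect summability.\<close>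
  then show ?thesis by (subst (asm) summable_Suc_iff)
qed

subsection \<open>Finite rank approximation of triangular operators\<close>

lemma rank_one_op:
  assumes "finite F" "v \<in> ell2"
  shows "bounded_op (\<lambda>x i. (\<Sum>j\<in>F. u j * x j) * v i)" "rank_le (\<lambda>x i. (\<Sum>j\<in>F. u j * x j) * v i) 1"
proof -
  show "bounded_op (\<lambda>x i. (\<Sum>j\<in>F. u j * x j) * v i)"
  proof (rule bounded_opI[where C = "(\<Sum>j\<in>F. cmod (u j)) * l2norm v"])
    fix x assume x: "x \<in> ell2"
    show "(\<lambda>i. (\<Sum>j\<in>F. u j * x j) * v i) \<in> ell2" by (rule ell2_scale[OF assms(2)])
    have "cmod (\<Sum>j\<in>F. u j * x j) \<le> (\<Sum>j\<in>F. cmod (u j) * l2norm x)"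
      by (intro sum_norm_le) (auto simp: norm_mult intro!: mult_left_mono cmod_le_l2norm x)
    then have "cmod (\<Sum>j\<in>F. u j * x j) \<le> (\<Sum>j\<in>F. cmod (u j)) * l2norm x"
      by (simp add: sum_distrib_right)
    from mult_right_mono[OF this l2norm_nonneg[OF assms(2)]]
    have "cmod (\<Sum>j\<in>F. u j * x j) * l2norm v \<le> ((\<Sum>j\<in>F. cmod (u j)) * l2norm v) * l2norm x"
      by (simp only: mult_ac)
    then show "l2norm (\<lambda>i. (\<Sum>j\<in>F. u j * x j) * v i) \<le> ((\<Sum>j\<in>F. cmod (u j)) * l2norm v) * l2norm x"
      by (simp only: l2norm_scale[OF assms(2)])
  next
    fix x y :: "nat \<Rightarrow> complex"
    show "(\<lambda>i. (\<Sum>j\<in>F. u j * (x j + y j)) * v i) =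
        (\<lambda>i. (\<Sum>j\<in>F. u j * x j) * v i + (\<Sum>j\<in>F. u j * y j) * v i)"
      by (simp add: distrib_left distrib_right sum.distrib)
  next
    fix a and x :: "nat \<Rightarrow> complex"
    have "(\<Sum>j\<in>F. u j * (a * x j)) = a * (\<Sum>j\<in>F. u j * x j)"
      by (simp add: sum_distrib_left mult.left_commute)
    then show "(\<lambda>i. (\<Sum>j\<in>F. u j * (a * x j)) * v i) = (\<lambda>i. a * ((\<Sum>j\<in>F. u j * x j) * v i))"
      by (simp add: mult.assoc)
  qed
  show "rank_le (\<lambda>x i. (\<Sum>j\<in>F. u j * x j) * v i) 1"
    unfolding rank_le_def
  proof (rule exI[of _ "\<lambda>k. v"], intro conjI allI impI ballI)
    fix x :: "nat \<Rightarrow> complex"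
    show "\<exists>a. (\<lambda>i. (\<Sum>j\<in>F. u j * x j) * v i) = (\<lambda>i. \<Sum>k<(1::nat). a k * v i)"
      by (rule exI[of _ "\<lambda>k. \<Sum>j\<in>F. u j * x j"]) simp
  qed (rule assms(2))
qed

lemma rank_le_mono: "rank_le P m \<Longrightarrow> m \<le> n \<Longrightarrow> rank_le P n"
  using rank_le_add[of P m "\<lambda>x i. 0" "n - m"] by simp

lemma finite_diagonal_op:
  assumes "finite F"
  shows "bounded_op (\<lambda>x i. if i \<in> F then a i * x i else 0) \<and>
    rank_le (\<lambda>x i. if i \<in> F then a i * x i else 0) (card F)"
  using assms
proof (induction F rule: finite_induct)
  case empty
  then show ?case by simp
next
  case (insert k F)
  have eq: "(\<lambda>x i. if i \<in> insert k F then a i * x i else 0) =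
      (\<lambda>x i. (\<Sum>j\<in>{k}. a j * x j) * unitv k i + (if i \<in> F then a i * x i else 0))"
    using insert(2) by (auto simp: fun_eq_iff unitv_def)
  have k: "bounded_op (\<lambda>x i. (\<Sum>j\<in>{k}. a j * x j) * unitv k i)"
    "rank_le (\<lambda>x i. (\<Sum>j\<in>{k}. a j * x j) * unitv k i) 1"
    by (rule rank_one_op; simp)+
  show ?case
    unfolding eq using bounded_op_add[OF k(1) insert(3)[THEN conjunct1]]
      rank_le_add[OF k(2) insert(3)[THEN conjunct2]] insert(1,2) by simp
qed

section \<open>Approximation on intervals of columns\<close>

definition vtri :: "nat \<Rightarrow> nat \<Rightarrow> (nat \<Rightarrow> complex) \<Rightarrow> (nat \<Rightarrow> complex) \<Rightarrow> nat \<Rightarrow> complex" where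
  "vtri a b w x i = (\<Sum>j\<in>{a..<b}. if i < j then w j * x j else 0)"

text \<open>The error must live on the rows of the interval and be measured against \<open>x\<close>
  on the same interval. Errors of adjacent intervals are then orthogonal and act on disjoint
  coordinates, so gluing adds ranks but keeps \<open>t\<close>.\<close>

definition approximable :: "(nat \<Rightarrow> complex) \<Rightarrow> real \<Rightarrow> nat \<Rightarrow> nat \<Rightarrow> nat \<Rightarrow> bool" where
  "approximable w t a b p \<longleftrightarrow> (\<exists>P. bounded_op P \<and> rank_le P p \<and>
     (\<forall>x i. i \<notin> {a..<b} \<longrightarrow> vtri a b w x i = P x i) \<and>
     (\<forall>x. (\<Sum>i\<in>{a..<b}. (cmod (vtri a b w x i - P x i))^2) \<le> t^2 * (\<Sum>i\<in>{a..<b}. (cmod (x i))^2)))"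

lemma approximableE:
  assumes "approximable w t a b p"
  obtains P where "bounded_op P" "rank_le P p" "\<forall>x i. i \<notin> {a..<b} \<longrightarrow> vtri a b w x i = P x i"
    "\<forall>x. (\<Sum>i\<in>{a..<b}. (cmod (vtri a b w x i - P x i))^2) \<le> t^2 * (\<Sum>i\<in>{a..<b}. (cmod (x i))^2)"
  using assms unfolding approximable_def by (elim exE conjE) (rule that)

lemma approximable_zero:
  assumes "\<And>j. j \<in> {a..<b} \<Longrightarrow> w j = 0"
  shows "approximable w t a b 0"
proof -
  have "vtri a b w x i = 0" for x i
    unfolding vtri_def using assms by (intro sum.neutral) auto
  then show ?thesis
    unfolding approximable_def by (intro exI[of _ "\<lambda>x i. 0"]) (auto simp: sum_nonneg)
qed

text \<open>Rows above the interval see the whole sum of the columns, a rank one contribution; the rest is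
  a strictly triangular matrix, estimated in Hilbert-Schmidt norm. Its last row vanishes, so
  intervals of length one cost nothing.\<close>

lemma approximable_one:
  assumes "real (b - a - 1) * (\<Sum>j\<in>{a..<b}. (cmod (w j))^2) \<le> t^2"
  shows "approximable w t a b 1"
proof -
  define v where "v i = (if i < a then 1 else 0 :: complex)" for i
  have v: "v \<in> ell2" by (rule ell2_finite_support[of "{..<a}"]) (auto simp: v_def)
  define P where "P = (\<lambda>x i. (\<Sum>j\<in>{a..<b}. w j * x j) * v i)"
  have P: "bounded_op P" "rank_le P 1" unfolding P_def by (rule rank_one_op; simp add: v)+
  have "vtri a b w x i = P x i" if "i \<notin> {a..<b}" for x i
  proof (cases "i < a")
    case True
    then show ?thesis unfolding vtri_def P_def by (simp add: v_def)
  next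
    case False
    then have "vtri a b w x i = 0" unfolding vtri_def using that by (intro sum.neutral) auto
    then show ?thesis using False by (simp add: P_def v_def)
  qed
  moreover have "(\<Sum>i\<in>{a..<b}. (cmod (vtri a b w x i - P x i))^2) \<le> t^2 * (\<Sum>i\<in>{a..<b}. (cmod (x i))^2)" for x
  proof -
    define W where "W = (\<Sum>j\<in>{a..<b}. (cmod (w j))^2)"
    define X where "X = (\<Sum>j\<in>{a..<b}. (cmod (x j))^2)"
    have X0: "0 \<le> X" by (simp add: X_def sum_nonneg)
    have le: "(cmod (vtri a b w x i))^2 \<le> W * X" for i
    proof -
      have "cmod (vtri a b w x i) \<le> (\<Sum>j\<in>{a..<b}. cmod (w j) * cmod (x j))"
        unfolding vtri_def by (intro sum_norm_le) (auto simp: norm_mult)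
      then have "(cmod (vtri a b w x i))^2 \<le> (\<Sum>j\<in>{a..<b}. cmod (w j) * cmod (x j))^2"
        by (intro power_mono) auto
      also have "\<dots> \<le> W * X" unfolding W_def X_def by (rule Cauchy_Schwarz_ineq_sum)
      finally show ?thesis .
    qed
    have last: "vtri a b w x (b - 1) = 0" unfolding vtri_def by (intro sum.neutral) auto
    have "(\<Sum>i\<in>{a..<b}. (cmod (vtri a b w x i - P x i))^2) = (\<Sum>i\<in>{a..<b}. (cmod (vtri a b w x i))^2)"
      by (intro sum.cong refl) (simp add: P_def v_def)
    also have "\<dots> = (\<Sum>i\<in>{a..<b-1}. (cmod (vtri a b w x i))^2)"
    proof (rule sum.mono_neutral_right)
      show "\<forall>i\<in>{a..<b} - {a..<b-1}. (cmod (vtri a b w x i))^2 = 0"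
      proof
        fix i assume "i \<in> {a..<b} - {a..<b-1}"
        then have "i = b - 1" by auto
        then show "(cmod (vtri a b w x i))^2 = 0" using last by simp
      qed
    qed auto
    also have "\<dots> \<le> (\<Sum>i\<in>{a..<b-1}. W * X)" by (intro sum_mono le)
    also have "\<dots> = (real (b - a - 1) * W) * X" by (simp add: diff_commute)
    also have "\<dots> \<le> t^2 * X" using assms X0 unfolding W_def by (rule mult_right_mono)
    finally show ?thesis by (simp add: X_def)
  qed
  ultimately show ?thesis unfolding approximable_def using P by blast
qed

text \<open>On the rows of either interval the other approximant is exact, so the squared errors
  simply add.\<close>

lemma approximable_glue:
  assumes "approximable w t a b p" "approximable w t b c q" "a \<le> b" "b \<le> c"
  shows "approximable w t a c (p + q)"
proof -
  obtain P where P: "bounded_op P" "rank_le P p" "\<forall>x i. i \<notin> {a..<b} \<longrightarrow> vtri a b w x i = P x i"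
    "\<forall>x. (\<Sum>i\<in>{a..<b}. (cmod (vtri a b w x i - P x i))^2) \<le> t^2 * (\<Sum>i\<in>{a..<b}. (cmod (x i))^2)"
    by (rule approximableE[OF assms(1)]) (rule that)
  obtain Q where Q: "bounded_op Q" "rank_le Q q" "\<forall>x i. i \<notin> {b..<c} \<longrightarrow> vtri b c w x i = Q x i"
    "\<forall>x. (\<Sum>i\<in>{b..<c}. (cmod (vtri b c w x i - Q x i))^2) \<le> t^2 * (\<Sum>i\<in>{b..<c}. (cmod (x i))^2)"
    by (rule approximableE[OF assms(2)]) (rule that)
  have v: "vtri a c w x i = vtri a b w x i + vtri b c w x i" for x i
    unfolding vtri_def using assms(3,4) by (simp add: sum.atLeastLessThan_concat)
  have "(\<Sum>i\<in>{a..<c}. (cmod (vtri a c w x i - (P x i + Q x i)))^2) \<le> t^2 * (\<Sum>i\<in>{a..<c}. (cmod (x i))^2)" for x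
  proof -
    have "(\<Sum>i\<in>{a..<c}. (cmod (vtri a c w x i - (P x i + Q x i)))^2) =
      (\<Sum>i\<in>{a..<b}. (cmod (vtri a c w x i - (P x i + Q x i)))^2) +
      (\<Sum>i\<in>{b..<c}. (cmod (vtri a c w x i - (P x i + Q x i)))^2)"
      using assms(3,4) by (simp add: sum.atLeastLessThan_concat)
    also have "(\<Sum>i\<in>{a..<b}. (cmod (vtri a c w x i - (P x i + Q x i)))^2) =
        (\<Sum>i\<in>{a..<b}. (cmod (vtri a b w x i - P x i))^2)"
      by (intro sum.cong refl) (simp add: v Q(3))
    also have "(\<Sum>i\<in>{b..<c}. (cmod (vtri a c w x i - (P x i + Q x i)))^2) =
        (\<Sum>i\<in>{b..<c}. (cmod (vtri b c w x i - Q x i))^2)"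
      by (intro sum.cong refl) (simp add: v P(3))
    also have "(\<Sum>i\<in>{a..<b}. (cmod (vtri a b w x i - P x i))^2) + \<dots> \<le>
        t^2 * (\<Sum>i\<in>{a..<b}. (cmod (x i))^2) + t^2 * (\<Sum>i\<in>{b..<c}. (cmod (x i))^2)"
      by (intro add_mono P(4)[rule_format] Q(4)[rule_format])
    also have "\<dots> = t^2 * (\<Sum>i\<in>{a..<c}. (cmod (x i))^2)"
      unfolding distrib_left[symmetric] using assms(3,4) by (simp add: sum.atLeastLessThan_concat)
    finally show ?thesis .
  qed
  moreover have "vtri a c w x i = P x i + Q x i" if "i \<notin> {a..<c}" for x i
  proof -
    have "i \<notin> {a..<b}" "i \<notin> {b..<c}" using that assms(3,4) by auto
    then show ?thesis by (simp add: v P(3) Q(3))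
  qed
  ultimately show ?thesis
    unfolding approximable_def
    by (intro exI[of _ "\<lambda>x i. P x i + Q x i"] conjI allI impI
        bounded_op_add[OF P(1) Q(1)] rank_le_add[OF P(2) Q(2)])
qed

text \<open>Cauchy-Schwarz in the plane. With lengths and weights as arguments, it makes
  \<open>sqrt (length * weight)\<close> superadditive over adjacent intervals.\<close>

lemma sqrt_mult_add_le:
  fixes a b c d :: real
  assumes "0 \<le> a" "0 \<le> b" "0 \<le> c" "0 \<le> d"
  shows "sqrt (a * b) + sqrt (c * d) \<le> sqrt ((a + c) * (b + d))"
proof (rule real_le_rsqrt)
  have "2 * (sqrt (a * d) * sqrt (b * c)) \<le> (sqrt (a * d))^2 + (sqrt (b * c))^2"
    using sum_squares_bound[of "sqrt (a * d)" "sqrt (b * c)"] by simp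
  moreover have "sqrt (a * d) * sqrt (b * c) = sqrt (a * b) * sqrt (c * d)"
    by (simp add: real_sqrt_mult)
  ultimately show "(sqrt (a * b) + sqrt (c * d))^2 \<le> (a + c) * (b + d)"
    using assms by (simp add: power2_sum algebra_simps)
qed

text \<open>Greedy splitting: cut off the shortest initial piece violating the estimate, together with its
  last point as a separate piece. Each such step lowers \<open>sqrt (length * weight)\<close> by at least \<open>t\<close>.\<close>

lemma approximable_interval:
  assumes "0 < t" "a \<le> b"
  shows "\<exists>p. approximable w t a b p \<and>
    real p \<le> 1 + 2 * sqrt (real (b - a) * (\<Sum>j\<in>{a..<b}. (cmod (w j))^2)) / t"
  using assms(2)
proof (induction "b - a" arbitrary: a rule: less_induct)
  case less
  define W where "W n = (\<Sum>j\<in>{a..<a+n}. (cmod (w j))^2)" for n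
  define good where "good n \<longleftrightarrow> real (n - 1) * W n \<le> t^2" for n
  have W0: "0 \<le> W n" for n by (simp add: W_def sum_nonneg)
  show ?case
  proof (cases "good (b - a)")
    case True
    then have "approximable w t a b 1"
      using less.prems by (intro approximable_one) (simp add: good_def W_def)
    moreover have "real 1 \<le> 1 + 2 * sqrt (real (b - a) * (\<Sum>j\<in>{a..<b}. (cmod (w j))^2)) / t"
      using assms(1) by (simp add: sum_nonneg)
    ultimately show ?thesis by blast
  next
    case False
    define n where "n = (LEAST n. \<not> good n)"
    have ng: "\<not> good n" unfolding n_def by (rule LeastI[of "\<lambda>n. \<not> good n", OF False])
    have nb: "n \<le> b - a" unfolding n_def by (rule Least_le[of "\<lambda>n. \<not> good n", OF False])
    have n1: "1 < n"
    proof (rule ccontr)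
      assume "\<not> 1 < n"
      then have "good n" by (simp add: good_def)
      then show False using ng by blast
    qed
    have g: "good (n - 1)" using not_less_Least[of "n - 1" "\<lambda>n. \<not> good n"] n1 by (simp flip: n_def)
    have 1: "approximable w t a (a + (n - 1)) 1"
      using g by (intro approximable_one) (simp add: good_def W_def)
    have 2: "approximable w t (a + (n - 1)) (a + n) 1"
      using n1 by (intro approximable_one) simp
    define W' where "W' = (\<Sum>j\<in>{a+n..<b}. (cmod (w j))^2)"
    have W'0: "0 \<le> W'" by (simp add: W'_def sum_nonneg)
    obtain p where p: "approximable w t (a + n) b p" "real p \<le> 1 + 2 * sqrt (real (b - (a + n)) * W') / t"
    proof -
      have "b - (a + n) < b - a" "a + n \<le> b" using nb n1 less.prems by linarith+
      from less.hyps[OF this] show ?thesis using that unfolding W'_def by blast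
    qed
    have "approximable w t a b (1 + 1 + p)"
      by (rule approximable_glue[OF approximable_glue[OF 1 2] p(1)]) (use nb n1 less.prems in auto)
    moreover have "real (1 + 1 + p) \<le> 1 + 2 * sqrt (real (b - a) * (\<Sum>j\<in>{a..<b}. (cmod (w j))^2)) / t"
    proof -
      \<comment> \<open>The \<open>n\<close> points cut off, including the offending last one, use
        up at least \<open>t\<close> of the quantity and pay for two ranks; hence the factor 2 in
        the bound.\<close>
      have "t^2 < real (n - 1) * W n" using ng by (simp add: good_def)
      also have "\<dots> \<le> real n * W n" by (intro mult_right_mono W0) simp
      finally have "t < sqrt (real n * W n)" by (rule real_less_rsqrt)
      moreover have "(\<Sum>j\<in>{a..<b}. (cmod (w j))^2) = W n + W'"
        unfolding W_def W'_def using nb less.prems by (intro sum.atLeastLessThan_concat[symmetric]) auto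
      moreover have "real (b - a) = real n + real (b - (a + n))" using nb less.prems by linarith
      ultimately have "t + sqrt (real (b - (a + n)) * W') \<le>
          sqrt (real (b - a) * (\<Sum>j\<in>{a..<b}. (cmod (w j))^2))"
        using sqrt_mult_add_le[of "real n" "W n" "real (b - (a + n))" W'] W0 W'0 by simp
      then have "2 * (t + sqrt (real (b - (a + n)) * W')) / t \<le>
          2 * sqrt (real (b - a) * (\<Sum>j\<in>{a..<b}. (cmod (w j))^2)) / t"
        using assms(1) by (intro divide_right_mono mult_left_mono) auto
      moreover have "2 * (t + sqrt (real (b - (a + n)) * W')) / t = 2 + 2 * sqrt (real (b - (a + n)) * W') / t"
        using assms(1) by (simp add: field_simps)
      ultimately show ?thesis using p(2) by simp
    qed
    ultimately show ?thesis by blast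
  qed
qed

text \<open>Index 1 is always kept, so that the complementary coefficients vanish there and
  smallness on the remaining blocks is enough for \<open>coeffs_le\<close>.\<close>

definition on_blocks :: "nat set \<Rightarrow> (nat \<Rightarrow> complex) \<Rightarrow> nat \<Rightarrow> complex" where
  "on_blocks S w j = (if j = 1 \<or> (\<exists>m\<in>S. j \<in> {2^m<..2^(m+1)}) then w j else 0)"

lemma on_blocks_in:
  "m \<in> S \<Longrightarrow> j \<in> {2^m<..2^(m+1)} \<Longrightarrow> on_blocks S w j = w j"
  unfolding on_blocks_def by (rule if_P) blast

lemma on_blocks_out:
  assumes "m \<notin> S" "j \<in> {2^m<..2^(m+1)}"
  shows "on_blocks S w j = 0"
  unfolding on_blocks_def
proof (rule if_not_P)
  have "(1::nat) \<le> 2^m" by simp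
  then have "j \<noteq> 1" using assms(2) by (auto simp del: one_le_power)
  then show "\<not> (j = 1 \<or> (\<exists>m\<in>S. j \<in> {2^m<..2^(m+1)}))"
    using dyadic_block_disjoint[OF assms(2)] assms(1) by blast
qed

text \<open>The leading 1 pays for column 1, an interval of one point. Blocks outside
  \<open>S\<close> cost nothing.\<close>

lemma approximable_on_blocks:
  assumes "0 < t" "\<And>m. m \<in> S \<Longrightarrow> t \<le> sqrt (blk w m)"
  shows "\<exists>p. approximable (on_blocks S w) t 1 (2^M + 1) p \<and>
    real p \<le> 1 + (\<Sum>m<M. if m \<in> S then 3 * sqrt (blk w m) / t else 0)"
proof (induction M)
  case 0
  have "approximable (on_blocks S w) t 1 (2^0 + 1) 1" by (rule approximable_one) simp
  then show ?case by (intro exI[of _ 1]) simp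
next
  case (Suc M)
  then obtain p where p: "approximable (on_blocks S w) t 1 (2^M + 1) p"
    "real p \<le> 1 + (\<Sum>m<M. if m \<in> S then 3 * sqrt (blk w m) / t else 0)" by blast
  have iv: "{2^M+1..<2^(M+1)+1} = {2^M<..2^(M+1)::nat}" by auto
  have "\<exists>r. approximable (on_blocks S w) t (2^M+1) (2^(M+1)+1) r \<and>
      real r \<le> (if M \<in> S then 3 * sqrt (blk w M) / t else 0)"
  proof (cases "M \<in> S")
    case True
    obtain r where r: "approximable (on_blocks S w) t (2^M+1) (2^(M+1)+1) r" "real r \<le> 1 + 2 * sqrt
        (real (2^(M+1)+1 - (2^M+1)) * (\<Sum>j\<in>{2^M+1..<2^(M+1)+1}. (cmod (on_blocks S w j))^2)) / t"
      using approximable_interval[OF assms(1), of "2^M+1" "2^(M+1)+1" "on_blocks S w"] by auto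
    have "(\<Sum>j\<in>{2^M+1..<2^(M+1)+1}. (cmod (on_blocks S w j))^2) = blksq w M"
      unfolding iv blksq_def by (intro sum.cong refl) (simp only: on_blocks_in[OF True])
    moreover have "real (2^(M+1)+1 - (2^M+1)) = 2^M" by simp
    ultimately have "real r \<le> 1 + 2 * sqrt (blk w M) / t" using r(2) by (simp only: blk_eq)
    \<comment> \<open>On the blocks of \<open>S\<close> the additive 1 is absorbed, which turns 2
      into 3 and keeps the count proportional to the block size.\<close>
    moreover have "1 \<le> sqrt (blk w M) / t" using assms(1) assms(2)[OF True] by simp
    ultimately have "real r \<le> 3 * sqrt (blk w M) / t" by simp
    then show ?thesis using r(1) True by auto
  next
    case False
    have "approximable (on_blocks S w) t (2^M+1) (2^(M+1)+1) 0"
      by (rule approximable_zero, unfold iv, rule on_blocks_out[OF False])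
    then show ?thesis using False by (intro exI[of _ 0]) simp
  qed
  then obtain r where r: "approximable (on_blocks S w) t (2^M+1) (2^(M+1)+1) r"
      "real r \<le> (if M \<in> S then 3 * sqrt (blk w M) / t else 0)" by blast
  have "approximable (on_blocks S w) t 1 (2^(M+1)+1) (p + r)"
    by (rule approximable_glue[OF p(1) r(1)]) auto
  moreover have "real (p + r) \<le> 1 + (\<Sum>m<Suc M. if m \<in> S then 3 * sqrt (blk w m) / t else 0)"
    using p(2) r(2) by simp
  ultimately show ?case unfolding Suc_eq_plus1[symmetric] by blast
qed

text \<open>Coefficients are split at the threshold. Small ones give an operator of norm
  \<open>O(t)\<close>; large diagonal entries are reproduced exactly, and large blocks through the
  interval approximation.\<close>

lemma Tmat_approximant:
  assumes AB: "coeffs_le A B c (incr c)" and t: "0 < t"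
    and fk: "finite {k. t \<le> cmod (c k)}" and fm: "finite {m. t \<le> sqrt (dyadic_block c m)}"
  shows "\<exists>p P. bounded_op P \<and> rank_le P p \<and>
    real p \<le> real (card {k. t \<le> cmod (c k)}) + 1 + 3 / t * (\<Sum>m | t \<le> sqrt (dyadic_block c m). sqrt (dyadic_block c m)) \<and>
    (\<forall>x\<in>ell2. l2norm (\<lambda>i. mat_apply (Tmat c) x i - P x i) \<le> 6 * t * l2norm x)"
proof -
  define F where "F = {k. t \<le> cmod (c k)}"
  define S where "S = {m. t \<le> sqrt (dyadic_block c m)}"
  define d where "d = incr c"
  obtain M where M: "S \<subseteq> {..<M}" using fm finite_nat_iff_bounded S_def by metis
  define cb where "cb i = (if i \<in> F then c i else 0)" for i
  define cs where "cs i = (if i \<in> F then 0 else c i)" for i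
  define wb where "wb = on_blocks S d"
  define ws where "ws j = d j - wb j" for j
  have wb_cases: "wb j = d j \<or> wb j = 0" for j unfolding wb_def on_blocks_def by presburger
  have blk_ws: "blk ws n \<le> t^2" for n
  proof (cases "n \<in> S")
    case True
    then have "blksq ws n = 0"
      unfolding blksq_def ws_def wb_def by (intro sum.neutral ballI) (simp only: on_blocks_in, simp)
    then show ?thesis by (simp add: blk_eq)
  next
    case False
    then have "sqrt (blk d n) \<le> t" by (simp add: S_def d_def dyadic_block_eq)
    then have "blk d n \<le> t^2" using t by (simp add: real_sqrt_le_iff' sqrt_le_D)
    moreover have "blk ws n \<le> blk d n"
    proof (rule blk_mono)
      show "cmod (ws j) \<le> cmod (d j)" for j using wb_cases[of j] by (auto simp: ws_def)
    qed
    ultimately show ?thesis by linarith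
  qed
  have sm: "coeffs_le t t cs ws"
    unfolding coeffs_le_def using t blk_ws
    by (auto simp: cs_def F_def ws_def wb_def on_blocks_def)
  \<comment> \<open>These coarse bounds only secure convergence of the rows, so that the operator
    splits as a sum.\<close>
  have bg: "coeffs_le A B cb wb"
  proof -
    have "cmod (wb j) \<le> cmod (d j)" for j using wb_cases[of j] by auto
    then have "blk wb n \<le> blk d n" for n by (rule blk_mono)
    moreover have "cmod (cb i) \<le> A" for i
      using AB order_trans[OF norm_ge_zero, of "c i" A] by (auto simp: coeffs_le_def cb_def)
    moreover have "wb 1 = d 1" by (simp add: wb_def on_blocks_def)
    ultimately show ?thesis using AB unfolding coeffs_le_def d_def by (metis order_trans)
  qed
  obtain p PV where PV: "bounded_op PV" "rank_le PV p"
    "\<forall>x i. i \<notin> {1..<2^M+1} \<longrightarrow> vtri 1 (2^M+1) wb x i = PV x i"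
    "\<forall>x. (\<Sum>i\<in>{1..<2^M+1}. (cmod (vtri 1 (2^M+1) wb x i - PV x i))^2) \<le>
      t^2 * (\<Sum>i\<in>{1..<2^M+1}. (cmod (x i))^2)"
    and p: "real p \<le> 1 + (\<Sum>m<M. if m \<in> S then 3 * sqrt (blk d m) / t else 0)"
  proof -
    have "\<And>m. m \<in> S \<Longrightarrow> t \<le> sqrt (blk d m)" by (simp add: S_def d_def dyadic_block_eq)
    from approximable_on_blocks[OF t this, of S M, folded wb_def]
    obtain p where ap: "approximable wb t 1 (2^M+1) p"
      and p: "real p \<le> 1 + (\<Sum>m<M. if m \<in> S then 3 * sqrt (blk d m) / t else 0)" by blast
    show ?thesis by (rule approximableE[OF ap]) (rule that[OF _ _ _ _ p])
  qed
  define PD where "PD = (\<lambda>x i. if i \<in> F then c i * x i else 0)"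
  have PD: "bounded_op PD" "rank_le PD (card F)"
    using finite_diagonal_op[of F c] fk unfolding PD_def F_def by blast+
  have wb0: "wb j = 0" if "j \<notin> {1..<2^M+1}" for j
  proof (cases "j = 0")
    case True
    then show ?thesis by (simp add: wb_def d_def incr_def on_blocks_def)
  next
    case False
    have "(2::nat)^(m+1) \<le> 2^M" if "m \<in> S" for m
      using that M by (intro power_increasing) auto
    then have "\<not> (\<exists>m\<in>S. j \<in> {2^m<..2^(m+1)})" using that False by fastforce
    moreover have "j \<noteq> 1" using that by (cases "j = 1") auto
    ultimately show ?thesis unfolding wb_def on_blocks_def by (intro if_not_P) blast
  qed
  have err: "l2norm (\<lambda>i. mat_apply (Tmat c) x i - (PD x i + PV x i)) \<le> 6 * t * l2norm x" if x: "x \<in> ell2" for x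
  proof -
    define e where "e = (\<lambda>i. vtri 1 (2^M+1) wb x i - PV x i)"
    have e0: "e i = 0" if "i \<notin> {1..<2^M+1}" for i using PV(3) that by (simp add: e_def)
    have el: "e \<in> ell2" using e0 by (intro ell2_finite_support[of "{1..<2^M+1}"]) auto
    have "(l2norm e)^2 = (\<Sum>i\<in>{1..<2^M+1}. (cmod (e i))^2)" using e0 by (intro l2norm_finite_support) auto
    also have "\<dots> \<le> t^2 * (\<Sum>i\<in>{1..<2^M+1}. (cmod (x i))^2)" unfolding e_def by (rule PV(4)[rule_format])
    also have "\<dots> \<le> t^2 * (l2norm x)^2" by (intro mult_left_mono sum_le_l2norm_power2 x) auto
    finally have "(l2norm e)^2 \<le> (t * l2norm x)^2" by (simp add: power_mult_distrib)
    then have en: "l2norm e \<le> t * l2norm x"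
      by (rule power2_le_imp_le) (use t l2norm_nonneg[OF x] in simp)
    \<comment> \<open>As \<open>S\<close> lies below \<open>M\<close>, the kept columns end at
      \<open>2^M\<close> and the series is a finite sum.\<close>
    have "tri wb x i = vtri 1 (2^M+1) wb x i" for i
      unfolding vtri_def by (rule tri_finite_support) (auto simp: wb0)
    moreover have "(\<lambda>i. cs i + cb i) = c" "(\<lambda>i. ws i + wb i) = incr c"
      by (auto simp: cs_def cb_def ws_def d_def)
    then have "mat_apply (Tmat c) x = (\<lambda>i. dtri cs ws x i + dtri cb wb x i)"
      using dtri_add_coeffs[OF sm bg x] coeffs_le_Tmat[OF AB x] by simp
    ultimately have "(\<lambda>i. mat_apply (Tmat c) x i - (PD x i + PV x i)) = (\<lambda>i. dtri cs ws x i + e i)"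
      by (auto simp: e_def dtri_def[of cb] PD_def cb_def)
    then have "l2norm (\<lambda>i. mat_apply (Tmat c) x i - (PD x i + PV x i)) \<le> l2norm (dtri cs ws x) + l2norm e"
      using l2norm_add[OF coeffs_leD(2)[OF sm x] el] by simp
    \<comment> \<open>Five parts of the constant 6 come from the small coefficients, with both
      bounds equal to \<open>t\<close>, and one from the interval approximation.\<close>
    also have "\<dots> \<le> (t + 4 * t) * l2norm x + t * l2norm x"
      by (intro add_mono en coeffs_leD(3)[OF sm x])
    finally show ?thesis by (simp add: algebra_simps)
  qed
  have "real (card F + p) \<le> real (card F) + 1 + 3 / t * (\<Sum>m\<in>S. sqrt (dyadic_block c m))"
  proof -
    have "(\<Sum>m<M. if m \<in> S then 3 * sqrt (blk d m) / t else 0) = (\<Sum>m\<in>S. 3 * sqrt (blk d m) / t)"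
      using M by (subst sum.inter_restrict[symmetric]) (auto simp: Int_absorb1)
    also have "\<dots> = 3 / t * (\<Sum>m\<in>S. sqrt (dyadic_block c m))"
      by (simp add: sum_distrib_left d_def dyadic_block_eq)
    finally show ?thesis using p by simp
  qed
  then show ?thesis
    using bounded_op_add[OF PD(1) PV(1)] rank_le_add[OF PD(2) PV(2)] err
    unfolding F_def[symmetric] S_def[symmetric]
    by (intro exI[of _ "card F + p"] exI[of _ "\<lambda>x i. PD x i + PV x i"]) blast
qed

text \<open>Applies \<open>Tmat_approximant\<close> at every threshold \<open>1 / 2^l\<close> and
  sums the resulting ranks with \<open>summable_powr_from_levels\<close>.\<close>

lemma matrix_schatten_TmatI:
  assumes q: "1 < q" and sc: "summable (\<lambda>k. cmod (c k) powr q)"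
    and sd: "summable (\<lambda>n. dyadic_block c n powr (q / 2))"
  shows "matrix_schatten q (Tmat c)"
proof -
  define \<beta> where "\<beta> n = sqrt (dyadic_block c n)" for n
  have dy0: "0 \<le> dyadic_block c n" for n by (simp add: dyadic_block_eq)
  have \<beta>0: "0 \<le> \<beta> n" for n using dy0 by (simp add: \<beta>_def)
  have "dyadic_block c n powr (q / 2) = \<beta> n powr q" for n
    using dy0[of n] by (simp add: \<beta>_def powr_half_sqrt[symmetric] powr_powr)
  then have s\<beta>: "summable (\<lambda>n. \<beta> n powr q)" using sd by simp
  have fk: "finite {k. t \<le> cmod (c k)}" and fm: "finite {m. t \<le> \<beta> m}" if "0 < t" for t
    using finite_level[OF sc _ that] finite_level[OF s\<beta> _ that] q by auto
  \<comment> \<open>Only finitely many values reach 1; this recovers boundedness of the operator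
    from summability.\<close>
  have "bdd_above (range f)" if "finite {k. 1 \<le> f k}" for f :: "nat \<Rightarrow> real"
  proof -
    have "range f \<subseteq> f ` {k. 1 \<le> f k} \<union> {..1}" by auto
    moreover have "bdd_above (f ` {k. 1 \<le> f k} \<union> {..1})" using that by auto
    ultimately show ?thesis by (rule bdd_above_mono[rotated])
  qed
  from this[OF fk] this[of "dyadic_block c"] fm[of 1]
  have "bdd_above (range (\<lambda>k. cmod (c k)))" "bdd_above (range (dyadic_block c))" by (auto simp: \<beta>_def)
  then obtain A B where AB: "coeffs_le A B c (incr c)" using bdd_coeffs_le by metis
  have b: "matrix_bounded (Tmat c)" by (rule coeffs_le_matrix_bounded[OF AB])
  have T: "bounded_op (mat_apply (Tmat c))" by (rule matrix_bounded_bounded_op[OF b])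
  obtain C where C: "0 \<le> C" "\<And>x. x \<in> ell2 \<Longrightarrow> l2norm (mat_apply (Tmat c) x) \<le> C * l2norm x"
    using bounded_op_norm[OF T] by metis
  define N where "N t = real (card {k. t \<le> cmod (c k)}) + 1 + 3 / t * (\<Sum>m | t \<le> \<beta> m. \<beta> m)" for t :: real
  have "\<forall>l::nat. \<exists>p. real p \<le> N (1 / 2^l) \<and> (\<exists>P. bounded_op P \<and> rank_le P p \<and>
    (\<forall>x\<in>ell2. l2norm (\<lambda>i. mat_apply (Tmat c) x i - P x i) \<le> 6 * (1 / 2^l) * l2norm x))"
  proof
    fix l :: nat
    have t: "0 < 1 / (2::real)^l" by simp
    show "\<exists>p. real p \<le> N (1 / 2^l) \<and> (\<exists>P. bounded_op P \<and> rank_le P p \<and>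
      (\<forall>x\<in>ell2. l2norm (\<lambda>i. mat_apply (Tmat c) x i - P x i) \<le> 6 * (1 / 2^l) * l2norm x))"
      using Tmat_approximant[OF AB t fk[OF t] fm[OF t, unfolded \<beta>_def]] unfolding N_def \<beta>_def by blast
  qed
  from choice[OF this] obtain p where p: "\<And>l. real (p l) \<le> N (1 / 2^l)"
    and P: "\<And>l. \<exists>P. bounded_op P \<and> rank_le P (p l) \<and>
    (\<forall>x\<in>ell2. l2norm (\<lambda>i. mat_apply (Tmat c) x i - P x i) \<le> 6 * (1 / 2^l) * l2norm x)" by blast
  have "summable (\<lambda>n. approx_num (mat_apply (Tmat c)) n powr q)"
  proof (rule summable_powr_from_levels)
    show "0 \<le> approx_num (mat_apply (Tmat c)) n" for n by (rule approx_num_nonneg[OF T])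
    show "approx_num (mat_apply (Tmat c)) n \<le> C" for n
      by (rule approx_num_le[OF T bounded_op_zero rank_le_zero]) (use C in auto)
    show "approx_num (mat_apply (Tmat c)) n \<le> 6 / 2^l" if "p l \<le> n" for l n
    proof -
      obtain P where P: "bounded_op P" "rank_le P (p l)"
        "\<forall>x\<in>ell2. l2norm (\<lambda>i. mat_apply (Tmat c) x i - P x i) \<le> 6 * (1 / 2^l) * l2norm x"
        using P[of l] by (elim exE conjE)
      show ?thesis by (rule approx_num_le[OF T P(1) rank_le_mono[OF P(2) that]]) (use P(3) in auto)
    qed
    show "summable (\<lambda>l. real (p l) * (1 / 2^l) powr q)"
    proof (rule summable_comparison_test'[of "\<lambda>l. N (1 / 2^l) * (1 / 2^l) powr q" 0])
      show "norm (real (p l) * (1 / 2^l) powr q) \<le> N (1 / 2^l) * (1 / 2^l) powr q" for l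
        using mult_right_mono[OF p[of l], of "(1 / 2^l) powr q"] by (simp add: abs_mult)
      have pos: "0 < a" if "1 / 2^l \<le> a" for a :: real and l :: nat
        by (rule less_le_trans[OF _ that]) simp
      \<comment> \<open>The weighted rank count falls into the diagonal count (\<theta> = 0), a
        geometric term for column 1, and the block part. In the last, the factor 1 / t lowers the
        exponent to q - 1, which is \<theta> = 1.\<close>
      have N: "N (1 / 2^l) * (1 / 2^l) powr q =
        (\<Sum>k | 1 / 2^l \<le> cmod (c k). cmod (c k) powr 0) * (1 / 2^l) powr (q - 0) + (2 powr (-q)) ^ l +
        3 * ((\<Sum>m | 1 / 2^l \<le> \<beta> m. \<beta> m powr 1) * (1 / 2^l) powr (q - 1))" for l
      proof -
        have "(\<Sum>k | 1 / 2^l \<le> cmod (c k). cmod (c k) powr 0) = real (card {k. 1 / 2^l \<le> cmod (c k)})"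
        proof -
          have "(\<Sum>k | 1 / 2^l \<le> cmod (c k). cmod (c k) powr 0) = (\<Sum>k | 1 / 2^l \<le> cmod (c k). 1)"
            using pos[of l] by (intro sum.cong refl) fastforce
          then show ?thesis by simp
        qed
        moreover have "(\<Sum>m | 1 / 2^l \<le> \<beta> m. \<beta> m powr 1) = (\<Sum>m | 1 / 2^l \<le> \<beta> m. \<beta> m)"
          using \<beta>0 by (intro sum.cong refl) simp
        moreover have "(1 / 2^l) powr q = (1 / 2^l) * (1 / 2^l) powr (q - 1)"
          by (subst powr_mult_base) auto
        then have "3 / (1 / 2^l) * (1 / 2^l) powr q = 3 * (1 / 2^l) powr (q - 1)" by simp
        then have "3 / (1 / 2^l) * Z * (1 / 2^l) powr q = 3 * (Z * (1 / 2^l) powr (q - 1))" for Z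
          by (metis mult.assoc mult.commute)
        ultimately show ?thesis unfolding N_def half_power_powr[of l q, symmetric]
          by (simp only: distrib_right mult_1 diff_zero)
      qed
      show "summable (\<lambda>l. N (1 / 2^l) * (1 / 2^l) powr q)"
        unfolding N using q two_powr_minus_less_1[of q]
        by (intro summable_add summable_mult summable_levels sc s\<beta> \<beta>0 summable_geometric) auto
    qed
  qed (use q in auto)
  then show ?thesis using b by (simp add: matrix_schatten_def)
qed

theorem theorem1p4:
  fixes c :: "nat \<Rightarrow> complex"
  shows "(matrix_bounded (Tmat c) \<longleftrightarrow>
            bdd_above (range (\<lambda>k. cmod (c k))) \<and> bdd_above (range (dyadic_block c)))
       \<and> (matrix_compact (Tmat c) \<longleftrightarrow>
            (\<lambda>k. cmod (c k)) \<longlonglongrightarrow> 0 \<and> dyadic_block c \<longlonglongrightarrow> 0)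
       \<and> (\<forall>q::real. 1 < q \<longrightarrow>
            (matrix_schatten q (Tmat c) \<longleftrightarrow>
               summable (\<lambda>k. cmod (c k) powr q) \<and>
               summable (\<lambda>n. dyadic_block c n powr (q / 2))))"
proof (intro conjI allI impI)
  show "matrix_bounded (Tmat c) \<longleftrightarrow>
      bdd_above (range (\<lambda>k. cmod (c k))) \<and> bdd_above (range (dyadic_block c))"
    by (rule matrix_bounded_Tmat_iff)
  show "matrix_compact (Tmat c) \<longleftrightarrow> (\<lambda>k. cmod (c k)) \<longlonglongrightarrow> 0 \<and> dyadic_block c \<longlonglongrightarrow> 0"
  proof (rule iffI, goal_cases)
    case 1
    show ?case by (rule conjI) (fact matrix_compact_Tmat_imp[OF 1])+
  next
    case 2
    show ?case by (rule matrix_compact_TmatI[OF conjunct1[OF 2] conjunct2[OF 2]])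
  qed
  fix q :: real
  assume q: "1 < q"
  show "matrix_schatten q (Tmat c) \<longleftrightarrow>
      summable (\<lambda>k. cmod (c k) powr q) \<and> summable (\<lambda>n. dyadic_block c n powr (q / 2))"
  proof (rule iffI, goal_cases)
    case 1
    show ?case
      by (rule conjI) (fact schatten_Tmat_imp_diagonal[OF 1 q] schatten_Tmat_imp_blocks[OF 1 q])+
  next
    case 2
    show ?case by (rule matrix_schatten_TmatI[OF q conjunct1[OF 2] conjunct2[OF 2]])
  qed
qed

end
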